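(* Let $G$ be a finite group and let $\mathsf{S}\subseteq Z(\mathbb{C}G)$ be a supercharacter theory of $G$. Write $\mathrm{Cl}(\mathsf{S})=\{C_1,\dotsc,C_n\}$, and let $g_i\in C_i$ for each $i$. Let $x_1,\dotsc,x_n$ be indeterminates. If $\mu$ is the regular representation of $\mathsf{S}$ (as an algebra under the ordinary product), then \[\det\left(\sum_{k=1}^n\mu\bigl(\widehat{C_k}\bigr)x_k\right)=\prod_{\chi\in\mathrm{BCh}(\mathsf{S})}\left(\sum_{k=1}^n\frac{\chi(g_k)\,|C_k|}{\chi(1)}\,x_k\right).\]
   Context: Let $G$ be a finite group and $\mathrm{Irr}(G)$ its set of irreducible complex characters. A supercharacter theory of $G$ is a subspace $\mathsf{S}$ of the center $Z(\mathbb{C}G)$ of the group algebra that is a unital subalgebra both for the ordinary product of $\mathbb{C}G$ (with unit $1$) and for the Hadamard product $\bigl(\sum_g a_g g\bigr)\circ\bigl(\sum_g b_g g\bigr)=\sum_g a_gb_g g$ (with unit $\sum_{g\in G} g$). For $K\subseteq G$ write $\widehat{K}=\sum_{g\in K}g$. For a supercharacter theory $\mathsf{S}$ there is a unique partition $\mathrm{Cl}(\mathsf{S})$ of $G$, whose parts are called $\mathsf{S}$-classes (superclasses), such that $\{\widehat{K}:K\in\mathrm{Cl}(\mathsf{S})\}$ is a basis of orthogonal idempotents of $\mathsf{S}$ for the Hadamard product; each $\mathsf{S}$-class is a union of conjugacy classes of $G$. For $\psi\in\mathrm{Irr}(G)$ let $e_\psi=\frac{\psi(1)}{|G|}\sum_{g\in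 G}\psi(g^{-1})g$. There is a unique partition $\mathrm{Ch}(\mathsf{S})$ of $\mathrm{Irr}(G)$ such that $\{\sum_{\psi\in X}e_\psi: X\in\mathrm{Ch}(\mathsf{S})\}$ is a basis of orthogonal idempotents of $\mathsf{S}$ for the ordinary product. For $X\subseteq\mathrm{Irr}(G)$ put $\sigma_X=\sum_{\psi\in X}\psi(1)\psi$. The set of basic $\mathsf{S}$-characters is $\mathrm{BCh}(\mathsf{S})=\{\sigma_X: X\in\mathrm{Ch}(\mathsf{S})\}$. The regular representation $\mu$ of the commutative algebra $\mathsf{S}$ sends $a\in\mathsf{S}$ to the matrix, with respect to the basis $\widehat{C_1},\dotsc,\widehat{C_n}$, of the linear map $\mathsf{S}\to\mathsf{S}$ given by multiplication by $a$ (ordinary product). *)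

theory Defs
  imports
    "HOL-Library.Function_Algebras"
    "HOL-Library.Poly_Mapping"
    "HOL-Library.Disjoint_Sets"
    "HOL-Library.Indicator_Function"
    "Jordan_Normal_Form.VS_Connect"
begin

section \<open>The group algebra\<close>

text \<open>An element \<open>\<Sum>\<^sub>g a\<^sub>g g\<close> of the complex group algebra of \<open>G\<close> is encoded by its coefficient
  function \<open>g \<mapsto> a\<^sub>g\<close>, which is required to vanish outside the carrier so that equality of elements
  is equality of functions. In this encoding the sum over a subset \<open>K\<close> of the carrier is
  \<open>indicator K\<close>, the unit is \<open>indicator {\<one>}\<close>, and the Hadamard product is the
  pointwise product \<open>(*)\<close> of functions. The linear algebra notions \<open>cfun.subspace\<close>, \<open>cfun.span\<close>,
  \<open>cfun.representation\<close> etc. are those of the complex vector space of all functions.\<close>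

interpretation cfun: vector_space "\<lambda>(c::complex) (f::'a \<Rightarrow> complex) x. c * f x"
  by unfold_locales (auto simp: fun_eq_iff algebra_simps)

definition group_algebra :: "('a, 'b) monoid_scheme \<Rightarrow> ('a \<Rightarrow> complex) set" where
  "group_algebra G = {a. \<forall>x. x \<notin> carrier G \<longrightarrow> a x = 0}"

definition ga_mult ::
  "('a, 'b) monoid_scheme \<Rightarrow> ('a \<Rightarrow> complex) \<Rightarrow> ('a \<Rightarrow> complex) \<Rightarrow> 'a \<Rightarrow> complex" where
  "ga_mult G a b = (\<lambda>x. if x \<in> carrier G
     then \<Sum>h\<in>carrier G. a h * b (inv\<^bsub>G\<^esub> h \<otimes>\<^bsub>G\<^esub> x) else 0)"

definition ga_center :: "('a, 'b) monoid_scheme \<Rightarrow> ('a \<Rightarrow> complex) set" where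
  "ga_center G = {z \<in> group_algebra G. \<forall>a \<in> group_algebra G. ga_mult G z a = ga_mult G a z}"

definition supercharacter_theory ::
  "('a, 'b) monoid_scheme \<Rightarrow> ('a \<Rightarrow> complex) set \<Rightarrow> bool" where
  "supercharacter_theory G S \<longleftrightarrow>
     S \<subseteq> ga_center G \<and> cfun.subspace S \<and>
     indicator {\<one>\<^bsub>G\<^esub>} \<in> S \<and> (\<forall>a\<in>S. \<forall>b\<in>S. ga_mult G a b \<in> S) \<and>
     indicator (carrier G) \<in> S \<and> (\<forall>a\<in>S. \<forall>b\<in>S. a * b \<in> S)"

definition orthogonal_idempotent_basis ::
  "(('a \<Rightarrow> complex) \<Rightarrow> ('a \<Rightarrow> complex) \<Rightarrow> 'a \<Rightarrow> complex) \<Rightarrow> ('a \<Rightarrow> complex) set \<Rightarrow>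
   ('a \<Rightarrow> complex) set \<Rightarrow> bool" where
  "orthogonal_idempotent_basis m S B \<longleftrightarrow>
     B \<subseteq> S \<and> cfun.independent B \<and> cfun.span B = S \<and>
     (\<forall>e\<in>B. m e e = e) \<and> (\<forall>e\<in>B. \<forall>f\<in>B. e \<noteq> f \<longrightarrow> m e f = 0)"

definition superclasses ::
  "('a, 'b) monoid_scheme \<Rightarrow> ('a \<Rightarrow> complex) set \<Rightarrow> 'a set set" where
  "superclasses G S = (THE P. partition_on (carrier G) P \<and>
     orthogonal_idempotent_basis (*) S (indicator ` P))"


section \<open>Irreducible complex characters\<close>

text \<open>The group of units of the ring of \<open>n\<close> by \<open>n\<close> matrices is the general linear group.\<close>

definition matrix_rep ::
  "('a, 'b) monoid_scheme \<Rightarrow> nat \<Rightarrow> ('a \<Rightarrow> complex mat) \<Rightarrow> bool" where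
  "matrix_rep G n \<rho> \<longleftrightarrow> \<rho> \<in> hom G (units_of (ring_mat TYPE(complex) n ()))"

definition irreducible_rep ::
  "('a, 'b) monoid_scheme \<Rightarrow> nat \<Rightarrow> ('a \<Rightarrow> complex mat) \<Rightarrow> bool" where
  "irreducible_rep G n \<rho> \<longleftrightarrow> matrix_rep G n \<rho> \<and> n > 0 \<and>
     (\<forall>W. VectorSpace.subspace class_ring W (module_vec TYPE(complex) n) \<and>
          (\<forall>g\<in>carrier G. \<forall>w\<in>W. \<rho> g *\<^sub>v w \<in> W)
        \<longrightarrow> W = {0\<^sub>v n} \<or> W = carrier_vec n)"

text \<open>Characters are extended by \<open>0\<close> outside the carrier, so that distinct elements of \<open>Irr G\<close>
  differ on the carrier.\<close>

definition rep_character ::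
  "('a, 'b) monoid_scheme \<Rightarrow> nat \<Rightarrow> ('a \<Rightarrow> complex mat) \<Rightarrow> 'a \<Rightarrow> complex" where
  "rep_character G n \<rho> = (\<lambda>g. if g \<in> carrier G then \<Sum>i<n. \<rho> g $$ (i, i) else 0)"

definition Irr :: "('a, 'b) monoid_scheme \<Rightarrow> ('a \<Rightarrow> complex) set" where
  "Irr G = {\<psi>. \<exists>n \<rho>. irreducible_rep G n \<rho> \<and> \<psi> = rep_character G n \<rho>}"

definition char_idempotent ::
  "('a, 'b) monoid_scheme \<Rightarrow> ('a \<Rightarrow> complex) \<Rightarrow> 'a \<Rightarrow> complex" where
  "char_idempotent G \<psi> = (\<lambda>g. if g \<in> carrier G
     then \<psi> \<one>\<^bsub>G\<^esub> / of_nat (card (carrier G)) * \<psi> (inv\<^bsub>G\<^esub> g) else 0)"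

definition superchar_partition ::
  "('a, 'b) monoid_scheme \<Rightarrow> ('a \<Rightarrow> complex) set \<Rightarrow> ('a \<Rightarrow> complex) set set" where
  "superchar_partition G S = (THE P. partition_on (Irr G) P \<and>
     orthogonal_idempotent_basis (ga_mult G) S ((\<lambda>X. \<Sum>\<psi>\<in>X. char_idempotent G \<psi>) ` P))"

definition sigma_char ::
  "('a, 'b) monoid_scheme \<Rightarrow> ('a \<Rightarrow> complex) set \<Rightarrow> 'a \<Rightarrow> complex" where
  "sigma_char G X = (\<lambda>g. \<Sum>\<psi>\<in>X. \<psi> \<one>\<^bsub>G\<^esub> * \<psi> g)"

definition basic_chars ::
  "('a, 'b) monoid_scheme \<Rightarrow> ('a \<Rightarrow> complex) set \<Rightarrow> ('a \<Rightarrow> complex) set" where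
  "basic_chars G S = sigma_char G ` superchar_partition G S"


section \<open>The regular representation and polynomials\<close>

text \<open>Column \<open>j\<close> contains the coordinates of \<open>a b\<^sub>j\<close> with respect to the ordered basis
  \<open>b\<^sub>0, \<dots>, b\<^sub>n\<^sub>-\<^sub>1\<close> of the algebra.\<close>

definition regular_rep ::
  "('a, 'b) monoid_scheme \<Rightarrow> nat \<Rightarrow> (nat \<Rightarrow> 'a \<Rightarrow> complex) \<Rightarrow> ('a \<Rightarrow> complex) \<Rightarrow> complex mat" where
  "regular_rep G n b a =
     mat n n (\<lambda>(i, j). cfun.representation (b ` {..<n}) (ga_mult G a (b j)) (b i))"

text \<open>Polynomials over the complex numbers in the indeterminates \<open>x\<^sub>k\<close>, \<open>k \<in> \<nat>\<close>: a monomial is a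
  finitely supported exponent function, and a polynomial is a finitely supported coefficient
  function on monomials.\<close>

type_synonym cpoly = "(nat \<Rightarrow>\<^sub>0 nat) \<Rightarrow>\<^sub>0 complex"

definition cpoly_const :: "complex \<Rightarrow> cpoly" where
  "cpoly_const c = Poly_Mapping.single 0 c"

definition cpoly_var :: "nat \<Rightarrow> cpoly" where
  "cpoly_var k = Poly_Mapping.single (Poly_Mapping.single k 1) 1"

end

theory Submission
  imports Defs "Jordan_Normal_Form.Spectral_Radius"
begin

text \<open>For an irreducible character \<open>\<psi>\<close> the center of the group algebra acts by the scalars
  \<open>\<omega>\<^sub>\<psi>(a) = (\<Sum>\<^sub>x a\<^sub>x \<psi>(x)) / \<psi>(1)\<close>. By Schur orthogonality \<open>\<omega>\<^sub>\<phi>(e\<^sub>\<psi>)\<close> is 1 for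
  \<open>\<phi> = \<psi>\<close> and 0 otherwise, and the \<open>\<omega>\<^sub>\<psi>\<close> separate the center: if \<open>a \<noteq> 0\<close> is central,
  it cannot vanish on a minimal left ideal inside \<open>a \<complex>G\<close>, because central elements are normal.
  Hence \<open>a \<mapsto> (\<omega>\<^sub>\<psi>(a))\<^sub>\<psi>\<close> turns convolution into a pointwise product, and both partitions attached to
  \<open>S\<close> come from the same fact: a unital subalgebra of the functions on a finite set is spanned by the
  indicators of the classes on which all its members are constant.

  The idempotents \<open>E\<^sub>X = \<Sum>\<^sub>\<psi>\<^sub>\<in>\<^sub>X e\<^sub>\<psi>\<close> form a basis of common eigenvectors of the regular
  representation, so the determinant is the product of the eigenvalues \<open>\<Sum>\<^sub>k \<omega>\<^sub>X(C\<^sub>k) x\<^sub>k\<close>. Since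
  \<open>E\<^sub>X(x\<^sup>-\<^sup>1) = \<sigma>\<^sub>X(x) / |G|\<close> and \<open>E\<^sub>X\<close> is self-adjoint, \<open>\<sigma>\<^sub>X\<close> is constant on
  superclasses, which gives \<open>\<omega>\<^sub>X(C\<^sub>k) = \<sigma>\<^sub>X(g\<^sub>k) |C\<^sub>k| / \<sigma>\<^sub>X(1)\<close>.\<close>

section \<open>Matrix representations and Schur's lemma\<close>

lemma vec_subspace_iff:
  "VectorSpace.subspace class_ring W (module_vec TYPE('k::field) n) \<longleftrightarrow>
     W \<subseteq> carrier_vec n \<and> 0\<^sub>v n \<in> W \<and> (\<forall>v\<in>W. \<forall>w\<in>W. v + w \<in> W) \<and> (\<forall>c. \<forall>v\<in>W. c \<cdot>\<^sub>v v \<in> W)"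
  unfolding VectorSpace.subspace_def submodule_def
  using vec_vs[where 'a='k, of n] vec_module[where 'a='k, of n]
  by (auto simp: module_vec_simps class_ring_simps)

text \<open>The factors may be rectangular: \<open>schur_intertwiner\<close> compares traces of two
  representations before their degrees are known to agree.\<close>

lemma trace_mult_commute:
  fixes A B :: "'k::comm_semiring_0 mat"
  assumes "A \<in> carrier_mat n m" "B \<in> carrier_mat m n"
  shows "(\<Sum>i<n. (A * B) $$ (i, i)) = (\<Sum>j<m. (B * A) $$ (j, j))"
proof -
  have "(\<Sum>i<n. (A * B) $$ (i, i)) = (\<Sum>i<n. \<Sum>j<m. A $$ (i, j) * B $$ (j, i))"
    using assms by (intro sum.cong) (auto simp: scalar_prod_def lessThan_atLeast0)
  also have "\<dots> = (\<Sum>j<m. \<Sum>i<n. B $$ (j, i) * A $$ (i, j))"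
    by (subst sum.swap) (simp add: mult.commute)
  also have "\<dots> = (\<Sum>j<m. (B * A) $$ (j, j))"
    using assms by (intro sum.cong) (auto simp: scalar_prod_def lessThan_atLeast0)
  finally show ?thesis .
qed

lemma mult_mat_index_sum:
  assumes "A \<in> carrier_mat n k" "B \<in> carrier_mat k m" "i < n" "j < m"
  shows "(A * B) $$ (i, j) = (\<Sum>p<k. A $$ (i, p) * B $$ (p, j))"
  using assms by (auto simp: scalar_prod_def lessThan_atLeast0)

lemma mult_mat_vec_index_sum:
  assumes "A \<in> carrier_mat n k" "v \<in> carrier_vec k" "i < n"
  shows "(A *\<^sub>v v) $ i = (\<Sum>p<k. A $$ (i, p) * v $ p)"
  using assms by (auto simp: scalar_prod_def lessThan_atLeast0)

lemma mat_eqI_mult_vec: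
  fixes A B :: "'k::comm_semiring_1 mat"
  assumes A: "A \<in> carrier_mat n m" and B: "B \<in> carrier_mat n m"
    and eq: "\<And>v. v \<in> carrier_vec m \<Longrightarrow> A *\<^sub>v v = B *\<^sub>v v"
  shows "A = B"
proof (rule eq_matI)
  fix i j assume "i < dim_row B" "j < dim_col B"
  hence i: "i < n" and j: "j < m" using B by auto
  have "A *\<^sub>v unit_vec m j = B *\<^sub>v unit_vec m j" by (rule eq) simp
  hence "(A *\<^sub>v unit_vec m j) $ i = (B *\<^sub>v unit_vec m j) $ i" by simp
  thus "A $$ (i, j) = B $$ (i, j)"
    using A B i j by (simp add: scalar_prod_right_unit)
qed (use A B in auto)

section \<open>Matrix representations of a group\<close>

lemma matrix_rep_carrier:
  "matrix_rep G n \<rho> \<Longrightarrow> g \<in> carrier G \<Longrightarrow> \<rho> g \<in> carrier_mat n n"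
  unfolding matrix_rep_def hom_def by (auto simp: units_of_def Units_def ring_mat_simps)

lemma matrix_rep_mult:
  "matrix_rep G n \<rho> \<Longrightarrow> g \<in> carrier G \<Longrightarrow> h \<in> carrier G \<Longrightarrow> \<rho> (g \<otimes>\<^bsub>G\<^esub> h) = \<rho> g * \<rho> h"
  unfolding matrix_rep_def hom_def by (auto simp: units_of_def ring_mat_simps)

lemma matrix_rep_one:
  assumes "group G" and \<rho>: "matrix_rep G n \<rho>"
  shows "\<rho> \<one>\<^bsub>G\<^esub> = 1\<^sub>m n"
proof -
  interpret R: ring "ring_mat TYPE(complex) n ()" by (rule ring_mat)
  have "group (units_of (ring_mat TYPE(complex) n ()))" by (rule R.units_group)
  from hom_one[OF \<rho>[unfolded matrix_rep_def] assms(1) this] show ?thesis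
    by (simp add: units_of_def ring_mat_simps)
qed

text \<open>The target of a representation is a group of units, so invertibility has to be supplied:
  the value at \<open>inv g\<close> is an inverse of the value at \<open>g\<close>.\<close>

lemma matrix_repI:
  assumes "group G" and c: "\<And>g. g \<in> carrier G \<Longrightarrow> \<rho> g \<in> carrier_mat n n"
    and m: "\<And>g h. g \<in> carrier G \<Longrightarrow> h \<in> carrier G \<Longrightarrow> \<rho> (g \<otimes>\<^bsub>G\<^esub> h) = \<rho> g * \<rho> h"
    and one: "\<rho> \<one>\<^bsub>G\<^esub> = 1\<^sub>m n"
  shows "matrix_rep G n \<rho>"
proof -
  interpret group G by fact
  have "\<rho> g \<in> Units (ring_mat TYPE(complex) n ())" if "g \<in> carrier G" for g
    using that c m[of g "inv\<^bsub>G\<^esub> g"] m[of "inv\<^bsub>G\<^esub> g" g] one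
    by (auto simp: Units_def ring_mat_simps intro!: bexI[of _ "\<rho> (inv\<^bsub>G\<^esub> g)"])
  thus ?thesis unfolding matrix_rep_def hom_def
    using m by (auto simp: units_of_def ring_mat_simps)
qed

section \<open>Invariant subspaces and Schur's lemma\<close>

lemma irreducible_rep_invariant:
  assumes "irreducible_rep G n \<rho>" "W \<subseteq> carrier_vec n" "0\<^sub>v n \<in> W"
    "\<And>v w. v \<in> W \<Longrightarrow> w \<in> W \<Longrightarrow> v + w \<in> W" "\<And>c v. v \<in> W \<Longrightarrow> c \<cdot>\<^sub>v v \<in> W"
    "\<And>g w. g \<in> carrier G \<Longrightarrow> w \<in> W \<Longrightarrow> \<rho> g *\<^sub>v w \<in> W"
  shows "W = {0\<^sub>v n} \<or> W = carrier_vec n"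
proof -
  have "VectorSpace.subspace class_ring W (module_vec TYPE(complex) n)"
    unfolding vec_subspace_iff using assms(2-5) by blast
  thus ?thesis using assms(1,6) unfolding irreducible_rep_def by blast
qed

text \<open>Kernel and image of \<open>A\<close> are invariant, so a nonzero \<open>A\<close> is
  injective and onto. Its inverse conjugates one representation into the other, and conjugation
  preserves the trace.\<close>

lemma schur_intertwiner:
  assumes \<rho>: "irreducible_rep G n \<rho>" and \<rho>': "irreducible_rep G m \<rho>'"
    and A: "A \<in> carrier_mat n m"
    and comm: "\<And>g. g \<in> carrier G \<Longrightarrow> \<rho> g * A = A * \<rho>' g" and nz: "A \<noteq> 0\<^sub>m n m"
  shows "rep_character G n \<rho> = rep_character G m \<rho>'"
proof -
  have r: "matrix_rep G n \<rho>" and r': "matrix_rep G m \<rho>'"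
    using \<rho> \<rho>' by (auto simp: irreducible_rep_def)
  note c = matrix_rep_carrier[OF r] and c' = matrix_rep_carrier[OF r']
  have inv: "\<rho> g *\<^sub>v (A *\<^sub>v v) = A *\<^sub>v (\<rho>' g *\<^sub>v v)"
    if "g \<in> carrier G" "v \<in> carrier_vec m" for g v
    using assoc_mult_mat_vec[OF c[OF that(1)] A that(2)] assoc_mult_mat_vec[OF A c'[OF that(1)] that(2)]
      comm[OF that(1)] by simp
  let ?K = "{v \<in> carrier_vec m. A *\<^sub>v v = 0\<^sub>v n}"
  have "?K = {0\<^sub>v m} \<or> ?K = carrier_vec m"
  proof (rule irreducible_rep_invariant[OF \<rho>'])
    fix g w assume g: "g \<in> carrier G" and w: "w \<in> ?K"
    have "A *\<^sub>v (\<rho>' g *\<^sub>v w) = \<rho> g *\<^sub>v 0\<^sub>v n" using inv[of g w] g w by simp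
    also have "\<dots> = 0\<^sub>v n" using c[OF g] by (auto simp: mult_mat_vec_def)
    finally show "\<rho>' g *\<^sub>v w \<in> ?K" using c'[OF g] w by auto
  qed (use A in \<open>auto simp: mult_add_distrib_mat_vec mult_mat_vec\<close>)
  moreover have "?K \<noteq> carrier_vec m"
  proof
    assume K: "?K = carrier_vec m"
    have "A = 0\<^sub>m n m"
    proof (rule mat_eqI_mult_vec[OF A])
      fix v :: "complex vec" assume v: "v \<in> carrier_vec m"
      hence "A *\<^sub>v v = 0\<^sub>v n" using K by blast
      thus "A *\<^sub>v v = 0\<^sub>m n m *\<^sub>v v" using v by auto
    qed auto
    thus False using nz by simp
  qed
  ultimately have K: "?K = {0\<^sub>v m}" by blast
  let ?I = "(\<lambda>v. A *\<^sub>v v) ` carrier_vec m"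
  have "?I = {0\<^sub>v n} \<or> ?I = carrier_vec n"
  proof (rule irreducible_rep_invariant[OF \<rho>])
    show "?I \<subseteq> carrier_vec n" using A by auto
    show "0\<^sub>v n \<in> ?I" using A by (auto intro!: image_eqI[of _ _ "0\<^sub>v m"])
    show "v + w \<in> ?I" if "v \<in> ?I" "w \<in> ?I" for v w
      using that A by (auto simp: mult_add_distrib_mat_vec[symmetric])
    show "k \<cdot>\<^sub>v v \<in> ?I" if "v \<in> ?I" for k v
      using that A by (auto simp: mult_mat_vec[symmetric])
    show "\<rho> g *\<^sub>v v \<in> ?I" if "g \<in> carrier G" "v \<in> ?I" for g v
      using that inv[OF that(1)] c'[OF that(1)] by auto
  qed
  moreover have "?I \<noteq> {0\<^sub>v n}"
  proof
    assume "?I = {0\<^sub>v n}"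
    hence "A *\<^sub>v unit_vec m 0 = 0\<^sub>v n" by (metis imageI singletonD unit_vec_carrier)
    hence "unit_vec m 0 \<in> ?K" by auto
    hence "unit_vec m 0 = (0\<^sub>v m :: complex vec)" using K by blast
    \<comment> \<open>The unit vector is nonzero because the degree \<open>m\<close> is
      positive.\<close>
    thus False using \<rho>' by (simp add: irreducible_rep_def)
  qed
  ultimately have I: "?I = carrier_vec n" by blast
  \<comment> \<open>Preimages of the unit vectors under the onto map \<open>A\<close> are the
    columns of a right inverse \<open>B\<close>.\<close>
  have "\<exists>b. b \<in> carrier_vec m \<and> A *\<^sub>v b = unit_vec n i" for i
  proof -
    have "unit_vec n i \<in> ?I" unfolding I by simp
    thus ?thesis by (metis imageE)
  qed
  then obtain b where b: "\<And>i. b i \<in> carrier_vec m" "\<And>i. A *\<^sub>v b i = unit_vec n i" by metis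
  define B where "B = mat m n (\<lambda>(i, j). b j $ i)"
  have B: "B \<in> carrier_mat m n" by (simp add: B_def)
  have AB: "A * B = 1\<^sub>m n"
  proof (rule eq_matI)
    fix i j assume "i < dim_row (1\<^sub>m n :: complex mat)" "j < dim_col (1\<^sub>m n :: complex mat)"
    hence ij: "i < n" "j < n" by auto
    have "(A * B) $$ (i, j) = (A *\<^sub>v b j) $ i"
      using A B b(1)[of j] ij unfolding mult_mat_index_sum[OF A B ij]
      by (auto simp: scalar_prod_def lessThan_atLeast0 B_def)
    thus "(A * B) $$ (i, j) = 1\<^sub>m n $$ (i, j)" using b(2)[of j] ij by (simp add: unit_vec_def)
  qed (use A B in auto)
  \<comment> \<open>Since \<open>A * B\<close> is the identity, \<open>A\<close> maps
    \<open>(B * A) *\<^sub>v v\<close> and \<open>v\<close> to the same vector; the kernel of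
    \<open>A\<close> is trivial, so \<open>B\<close> is a left inverse too.\<close>
  have BA: "B * A = 1\<^sub>m m"
  proof (rule mat_eqI_mult_vec)
    fix v :: "complex vec" assume v: "v \<in> carrier_vec m"
    let ?u = "(B * A) *\<^sub>v v - v"
    have Av: "A *\<^sub>v v \<in> carrier_vec n" using A v by simp
    have BAv: "(B * A) *\<^sub>v v \<in> carrier_vec m" using A B v by simp
    have "(B * A) *\<^sub>v v = B *\<^sub>v (A *\<^sub>v v)" using B A v by (rule assoc_mult_mat_vec)
    hence "A *\<^sub>v ((B * A) *\<^sub>v v) = (A * B) *\<^sub>v (A *\<^sub>v v)"
      using assoc_mult_mat_vec[OF A B Av] by simp
    hence "A *\<^sub>v ((B * A) *\<^sub>v v) = A *\<^sub>v v" using AB Av by simp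
    hence "A *\<^sub>v ?u = 0\<^sub>v n" using A v BAv Av by (simp add: mult_minus_distrib_mat_vec)
    hence "?u \<in> ?K" using v BAv by simp
    hence u: "?u = 0\<^sub>v m" using K by blast
    have "(B * A) *\<^sub>v v = v"
    proof (rule eq_vecI)
      fix i assume "i < dim_vec v"
      hence "?u $ i = 0" using u v by simp
      thus "((B * A) *\<^sub>v v) $ i = v $ i" using \<open>i < dim_vec v\<close> v BAv by simp
    qed (use v B in auto)
    thus "(B * A) *\<^sub>v v = 1\<^sub>m m *\<^sub>v v" using v by simp
  qed (use A B in auto)
  show ?thesis
  proof
    fix g
    show "rep_character G n \<rho> g = rep_character G m \<rho>' g"
    proof (cases "g \<in> carrier G")
      case g: True
      have "\<rho> g = \<rho> g * (A * B)" using c[OF g] AB by simp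
      also have "\<dots> = A * \<rho>' g * B"
        using assoc_mult_mat[OF c[OF g] A B] comm[OF g] by simp
      also have "\<dots> = A * (\<rho>' g * B)" using c'[OF g] A B by simp
      finally have "(\<Sum>i<n. \<rho> g $$ (i, i)) = (\<Sum>i<n. (A * (\<rho>' g * B)) $$ (i, i))" by simp
      also have "\<dots> = (\<Sum>j<m. ((\<rho>' g * B) * A) $$ (j, j))"
        using c'[OF g] A B by (intro trace_mult_commute) auto
      also have "(\<rho>' g * B) * A = \<rho>' g" using c'[OF g] A B BA by (simp add: assoc_mult_mat[of _ m m _ n _ m])
      finally show ?thesis using g by (simp add: rep_character_def)
    qed (simp add: rep_character_def)
  qed
qed

text \<open>An eigenspace of \<open>A\<close> is invariant under every matrix commuting with
  \<open>A\<close>. Over the complex numbers some eigenspace is nonzero, and irreducibility makes it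
  the whole space.\<close>

lemma schur_scalar:
  assumes \<rho>: "irreducible_rep G n \<rho>" and A: "A \<in> carrier_mat n n"
    and comm: "\<And>g. g \<in> carrier G \<Longrightarrow> \<rho> g * A = A * \<rho> g"
  shows "\<exists>c. A = c \<cdot>\<^sub>m 1\<^sub>m n"
proof -
  have r: "matrix_rep G n \<rho>" and n: "n > 0"
    using \<rho> by (auto simp: irreducible_rep_def)
  from spectrum_non_empty[OF A n] obtain k v where ev: "eigenvector A v k"
    by (auto simp: spectrum_def eigenvalue_def)
  let ?K = "{v \<in> carrier_vec n. A *\<^sub>v v = k \<cdot>\<^sub>v v}"
  have "?K = {0\<^sub>v n} \<or> ?K = carrier_vec n"
  proof (rule irreducible_rep_invariant[OF \<rho>])
    fix g w assume g: "g \<in> carrier G" and w: "w \<in> ?K"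
    note c = matrix_rep_carrier[OF r g]
    have "A *\<^sub>v (\<rho> g *\<^sub>v w) = \<rho> g *\<^sub>v (A *\<^sub>v w)"
      using assoc_mult_mat_vec[OF c A, of w] assoc_mult_mat_vec[OF A c, of w] w comm[OF g] by simp
    also have "\<dots> = k \<cdot>\<^sub>v (\<rho> g *\<^sub>v w)" using w c by (simp add: mult_mat_vec)
    finally show "\<rho> g *\<^sub>v w \<in> ?K" using c w by auto
  next
    show "v + w \<in> ?K" if "v \<in> ?K" "w \<in> ?K" for v w
      using that A by (auto simp: mult_add_distrib_mat_vec smult_add_distrib_vec)
    show "c \<cdot>\<^sub>v v \<in> ?K" if "v \<in> ?K" for c v
      using that A by (auto simp: mult_mat_vec smult_smult_assoc mult.commute)
    show "0\<^sub>v n \<in> ?K" using A by auto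
  qed auto
  moreover have "v \<in> ?K" "v \<noteq> 0\<^sub>v n" using ev A by (auto simp: eigenvector_def)
  ultimately have K: "?K = carrier_vec n" by blast
  have "A = k \<cdot>\<^sub>m 1\<^sub>m n"
  proof (rule mat_eqI_mult_vec[OF A])
    fix v :: "complex vec" assume v: "v \<in> carrier_vec n"
    hence "A *\<^sub>v v = k \<cdot>\<^sub>v v" using K by blast
    thus "A *\<^sub>v v = (k \<cdot>\<^sub>m 1\<^sub>m n) *\<^sub>v v" using v by (auto intro!: eq_vecI simp: mult_mat_vec_def)
  qed auto
  thus ?thesis ..
qed

section \<open>The group algebra of a finite group\<close>

lemma sum_fun_apply: "(\<Sum>i\<in>I. f i) x = (\<Sum>i\<in>I. f i x)" for f :: "'i \<Rightarrow> 'a \<Rightarrow> 'b::comm_monoid_add"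
  by (induction I rule: infinite_finite_induct) auto

locale finite_group = group G for G (structure) +
  assumes finite_carrier [simp, intro]: "finite (carrier G)"
begin

section \<open>Sums over the group and the convolution product\<close>

lemma sum_inverse: "(\<Sum>x\<in>carrier G. f (inv x)) = (\<Sum>x\<in>carrier G. f x)"
  by (rule sum.reindex_bij_witness[of _ "\<lambda>x. inv x" "\<lambda>x. inv x"]) auto

lemma sum_translate:
  assumes "h \<in> carrier G"
  shows "(\<Sum>x\<in>carrier G. f (h \<otimes> x)) = (\<Sum>x\<in>carrier G. f x)"
  using assms
  by (intro sum.reindex_bij_witness[of _ "\<lambda>x. inv h \<otimes> x" "\<lambda>x. h \<otimes> x"]) (auto simp: m_assoc[symmetric])

lemma ga_mult_apply:
  "x \<in> carrier G \<Longrightarrow> ga_mult G a b x = (\<Sum>h\<in>carrier G. a h * b (inv h \<otimes> x))"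
  by (simp add: ga_mult_def)

text \<open>Substituting x h for h and then inverting h lets the second factor run freely over the
  group, the form suited to multiplying on the right by a group element.\<close>

lemma ga_mult_apply':
  assumes x: "x \<in> carrier G"
  shows "ga_mult G a b x = (\<Sum>h\<in>carrier G. a (x \<otimes> inv h) * b h)"
proof -
  have "ga_mult G a b x = (\<Sum>h\<in>carrier G. a (x \<otimes> h) * b (inv (x \<otimes> h) \<otimes> x))"
    unfolding ga_mult_apply[OF x] using sum_translate[OF x, of "\<lambda>h. a h * b (inv h \<otimes> x)"] by simp
  also have "\<dots> = (\<Sum>h\<in>carrier G. a (x \<otimes> h) * b (inv h))"
    using x by (intro sum.cong) (auto simp: inv_mult_group m_assoc)
  also have "\<dots> = (\<Sum>h\<in>carrier G. a (x \<otimes> inv h) * b h)"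
    using sum_inverse[of "\<lambda>h. a (x \<otimes> inv h) * b h"] by simp
  finally show ?thesis .
qed

lemma ga_mult_closed [simp]: "ga_mult G a b \<in> group_algebra G"
  by (simp add: group_algebra_def ga_mult_def)

lemma group_algebra_eqI:
  assumes "a \<in> group_algebra G" "b \<in> group_algebra G" "\<And>x. x \<in> carrier G \<Longrightarrow> a x = b x"
  shows "a = b"
proof
  fix x show "a x = b x"
    using assms by (cases "x \<in> carrier G") (auto simp: group_algebra_def)
qed

lemma ga_mult_assoc: "ga_mult G (ga_mult G a b) c = ga_mult G a (ga_mult G b c)"
proof (rule group_algebra_eqI)
  fix x assume x: "x \<in> carrier G"
  have "ga_mult G (ga_mult G a b) c x = (\<Sum>k\<in>carrier G. \<Sum>h\<in>carrier G. a h * b (inv h \<otimes> (x \<otimes> inv k)) * c k)"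
    unfolding ga_mult_apply'[OF x] using x by (simp add: ga_mult_apply sum_distrib_right)
  also have "\<dots> = (\<Sum>h\<in>carrier G. \<Sum>k\<in>carrier G. a h * b (inv h \<otimes> (x \<otimes> inv k)) * c k)"
    by (rule sum.swap)
  also have "\<dots> = ga_mult G a (ga_mult G b c) x"
    unfolding ga_mult_apply[OF x] using x
    by (simp add: ga_mult_apply' sum_distrib_left m_assoc mult.assoc)
  finally show "ga_mult G (ga_mult G a b) c x = ga_mult G a (ga_mult G b c) x" .
qed auto

lemma ga_mult_add_right: "ga_mult G a (b + c) = ga_mult G a b + ga_mult G a c"
  by (auto simp: ga_mult_def fun_eq_iff algebra_simps sum.distrib)

lemma ga_mult_scale_right: "ga_mult G a (\<lambda>x. c * b x) = (\<lambda>x. c * ga_mult G a b x)"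
  by (auto simp: ga_mult_def fun_eq_iff sum_distrib_left mult.left_commute)

lemma ga_mult_zero_right [simp]: "ga_mult G b 0 = 0"
  by (auto simp: ga_mult_def fun_eq_iff)

lemma ga_mult_indicator_left:
  assumes y: "y \<in> carrier G" and x: "x \<in> carrier G"
  shows "ga_mult G (indicator {y}) a x = a (inv y \<otimes> x)"
proof -
  have "ga_mult G (indicator {y}) a x = (\<Sum>h\<in>carrier G. if h = y then a (inv y \<otimes> x) else 0)"
    unfolding ga_mult_apply[OF x] by (intro sum.cong) (auto simp: indicator_def)
  thus ?thesis using y by simp
qed

lemma ga_mult_indicator_right:
  assumes y: "y \<in> carrier G" and x: "x \<in> carrier G"
  shows "ga_mult G a (indicator {y}) x = a (x \<otimes> inv y)"
proof -
  have "ga_mult G a (indicator {y}) x = (\<Sum>h\<in>carrier G. if h = y then a (x \<otimes> inv y) else 0)"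
    unfolding ga_mult_apply'[OF x] by (intro sum.cong) (auto simp: indicator_def)
  thus ?thesis using y by simp
qed

lemma indicator_group_algebra [simp]: "K \<subseteq> carrier G \<Longrightarrow> indicator K \<in> group_algebra G"
  by (auto simp: group_algebra_def indicator_def)

lemma ga_mult_one_left: "a \<in> group_algebra G \<Longrightarrow> ga_mult G (indicator {\<one>}) a = a"
  by (rule group_algebra_eqI) (auto simp: ga_mult_indicator_left)

lemma ga_mult_one_right: "a \<in> group_algebra G \<Longrightarrow> ga_mult G a (indicator {\<one>}) = a"
  by (rule group_algebra_eqI) (auto simp: ga_mult_indicator_right)

lemma group_algebra_subspace: "cfun.subspace (group_algebra G)"
  by (auto simp: cfun.subspace_def group_algebra_def)

lemma group_algebra_span:
  "group_algebra G \<subseteq> cfun.span ((\<lambda>x. indicator {x}) ` carrier G)"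
proof
  fix a assume a: "a \<in> group_algebra G"
  have "a = (\<Sum>x\<in>carrier G. (\<lambda>y. a x * indicator {x} y))"
  proof
    fix y
    have "(\<Sum>x\<in>carrier G. a x * indicator {x} y) = (\<Sum>x\<in>carrier G. if x = y then a x else 0)"
      by (intro sum.cong) (auto simp: indicator_def)
    thus "a y = (\<Sum>x\<in>carrier G. (\<lambda>y. a x * indicator {x} y)) y"
      using a by (auto simp: sum_fun_apply group_algebra_def)
  qed
  moreover have "(\<Sum>x\<in>carrier G. (\<lambda>y. a x * indicator {x} y))
      \<in> cfun.span ((\<lambda>x. indicator {x}) ` carrier G)"
    by (intro cfun.span_sum cfun.span_scale cfun.span_base) auto
  ultimately show "a \<in> cfun.span ((\<lambda>x. indicator {x}) ` carrier G)" by simp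
qed

text \<open>The group elements form a finite spanning set, so the group algebra is finite
  dimensional even when the ambient space of all functions is not.\<close>

lemma independent_finite:
  assumes "B \<subseteq> group_algebra G" "cfun.independent B"
  shows "finite B"
  using cfun.independent_span_bound[OF _ assms(2), of "(\<lambda>x. indicator {x}) ` carrier G"]
    assms(1) group_algebra_span by blast

section \<open>The center as the space of class functions\<close>

lemma center_group_algebra: "a \<in> ga_center G \<Longrightarrow> a \<in> group_algebra G"
  by (simp add: ga_center_def)

lemma center_commute:
  "a \<in> ga_center G \<Longrightarrow> b \<in> group_algebra G \<Longrightarrow> ga_mult G a b = ga_mult G b a"
  by (simp add: ga_center_def)

lemma center_iff_class_function:
  "a \<in> ga_center G \<longleftrightarrow> a \<in> group_algebra G \<and>
     (\<forall>x\<in>carrier G. \<forall>y\<in>carrier G. a (x \<otimes> y) = a (y \<otimes> x))"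
proof safe
  fix x y assume a: "a \<in> ga_center G" and xy: "x \<in> carrier G" "y \<in> carrier G"
  \<comment> \<open>Commuting with the single group element \<open>inv y\<close>, read at the
    coefficient of x, is the required identity.\<close>
  have "ga_mult G a (indicator {inv y}) x = ga_mult G (indicator {inv y}) a x"
    using center_commute[OF a, of "indicator {inv y}"] xy by simp
  thus "a (x \<otimes> y) = a (y \<otimes> x)"
    using xy by (simp add: ga_mult_indicator_left ga_mult_indicator_right)
next
  assume a: "a \<in> group_algebra G" and cl: "\<forall>x\<in>carrier G. \<forall>y\<in>carrier G. a (x \<otimes> y) = a (y \<otimes> x)"
  have "ga_mult G a b = ga_mult G b a" for b
  proof (rule group_algebra_eqI)
    fix x assume x: "x \<in> carrier G"
    show "ga_mult G a b x = ga_mult G b a x"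
      unfolding ga_mult_apply'[OF x, of a] ga_mult_apply[OF x, of b]
      using cl x by (intro sum.cong) auto
  qed auto
  thus "a \<in> ga_center G" using a by (simp add: ga_center_def)
qed (auto simp: ga_center_def)

section \<open>The involution of the group algebra and its positivity\<close>

definition ga_star :: "('a \<Rightarrow> complex) \<Rightarrow> 'a \<Rightarrow> complex" where
  "ga_star a = (\<lambda>x. if x \<in> carrier G then cnj (a (inv x)) else 0)"

lemma ga_star_closed [simp]: "ga_star a \<in> group_algebra G"
  by (simp add: ga_star_def group_algebra_def)

lemma ga_star_star [simp]: "a \<in> group_algebra G \<Longrightarrow> ga_star (ga_star a) = a"
  by (rule group_algebra_eqI[OF ga_star_closed]) (auto simp: ga_star_def)

text \<open>Inversion reverses products. Consequently multiplication by \<open>ga_star a\<close> is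
  the adjoint of multiplication by \<open>a\<close> for the inner product that makes the group
  elements orthonormal.\<close>

lemma ga_star_mult: "ga_star (ga_mult G a b) = ga_mult G (ga_star b) (ga_star a)"
proof (rule group_algebra_eqI)
  fix x assume x: "x \<in> carrier G"
  have "ga_star (ga_mult G a b) x = (\<Sum>h\<in>carrier G. cnj (a h) * cnj (b (inv h \<otimes> inv x)))"
    using x by (simp add: ga_star_def ga_mult_apply)
  also have "\<dots> = (\<Sum>h\<in>carrier G. cnj (a (inv h)) * cnj (b (inv (inv h) \<otimes> inv x)))"
    by (rule sum_inverse[symmetric])
  also have "\<dots> = ga_mult G (ga_star b) (ga_star a) x"
    unfolding ga_mult_apply'[OF x]
    using x by (intro sum.cong) (auto simp: ga_star_def inv_mult_group)
  finally show "ga_star (ga_mult G a b) x = ga_mult G (ga_star b) (ga_star a) x" .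
qed auto

lemma ga_star_center: "a \<in> ga_center G \<Longrightarrow> ga_star a \<in> ga_center G"
  unfolding center_iff_class_function
  by (intro conjI ga_star_closed) (auto simp: ga_star_def inv_mult_group)

text \<open>The coefficient of \<open>a\<^sup>* a\<close> at the unit is the sum of the squared absolute values of the
  coefficients of \<open>a\<close>.\<close>

lemma ga_star_mult_eq_zero:
  assumes a: "a \<in> group_algebra G" and z: "ga_mult G (ga_star a) a = 0"
  shows "a = 0"
proof -
  have "0 = ga_mult G (ga_star a) a \<one>" using z by simp
  also have "\<dots> = (\<Sum>h\<in>carrier G. cnj (a h) * a h)"
    unfolding ga_mult_apply'[OF one_closed] by (intro sum.cong) (auto simp: ga_star_def)
  also have "\<dots> = of_real (\<Sum>h\<in>carrier G. (cmod (a h))\<^sup>2)"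
    by (simp add: complex_norm_square mult.commute[of "cnj _"] del: of_real_power)
  finally have "(\<Sum>h\<in>carrier G. (cmod (a h))\<^sup>2) = 0" by (metis of_real_eq_0_iff)
  hence "\<forall>h\<in>carrier G. a h = 0" by (subst (asm) sum_nonneg_eq_0_iff) auto
  thus ?thesis using a by (auto simp: group_algebra_def fun_eq_iff)
qed

text \<open>Central elements are normal, so \<open>a\<^sup>2 c = 0\<close> gives \<open>a\<^sup>* a c = 0\<close> and then
  \<open>(a c)\<^sup>* (a c) = 0\<close>.\<close>

lemma center_mult_square_zero:
  assumes a: "a \<in> ga_center G" and z: "ga_mult G a (ga_mult G a c) = 0"
  shows "ga_mult G a c = 0"
proof -
  note ac = center_group_algebra[OF a] and assoc = ga_mult_assoc[symmetric]
  define w where "w = ga_mult G a c"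
  define u where "u = ga_mult G (ga_star a) w"
  have [simp]: "w \<in> group_algebra G" "u \<in> group_algebra G" by (simp_all add: w_def u_def)
  have "ga_mult G a u = ga_mult G (ga_mult G a (ga_star a)) w"
    by (simp add: u_def assoc)
  also have "\<dots> = ga_mult G (ga_star a) (ga_mult G a w)"
    using center_commute[OF a ga_star_closed[of a]] by (simp add: assoc)
  finally have au: "ga_mult G a u = 0" using z by (simp add: w_def)
  have "ga_mult G (ga_star u) u = ga_mult G (ga_star w) (ga_mult G a u)"
    unfolding u_def ga_star_mult using ac by (simp add: ga_mult_assoc)
  hence "ga_mult G (ga_star u) u = 0" using au by simp
  hence "u = 0" by (rule ga_star_mult_eq_zero[rotated]) simp
  moreover have "ga_mult G (ga_star w) w = ga_mult G (ga_star c) u"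
    unfolding u_def by (subst (1) w_def) (simp add: ga_star_mult ga_mult_assoc)
  ultimately have "ga_mult G (ga_star w) w = 0" by simp
  hence "w = 0" by (rule ga_star_mult_eq_zero[rotated]) simp
  thus ?thesis by (simp add: w_def)
qed

section \<open>Central characters\<close>


text \<open>The linear extension of a representation to the group algebra;
  \<open>rep_extend_mult\<close> shows that it respects products.\<close>

definition rep_extend :: "nat \<Rightarrow> ('a \<Rightarrow> complex mat) \<Rightarrow> ('a \<Rightarrow> complex) \<Rightarrow> complex mat" where
  "rep_extend n \<rho> a = mat n n (\<lambda>(i, j). \<Sum>x\<in>carrier G. a x * \<rho> x $$ (i, j))"

text \<open>For irreducible \<psi> and central \<open>a\<close> this is the scalar by which
  \<open>a\<close> acts, by \<open>rep_extend_center\<close>; for other \<open>a\<close> it is only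
  the normalized trace of the action.\<close>

definition central_char :: "('a \<Rightarrow> complex) \<Rightarrow> ('a \<Rightarrow> complex) \<Rightarrow> complex" where
  "central_char \<psi> a = (\<Sum>x\<in>carrier G. a x * \<psi> x) / \<psi> \<one>"

lemma rep_extend_carrier [simp]: "rep_extend n \<rho> a \<in> carrier_mat n n"
  by (simp add: rep_extend_def)

lemma matrix_rep_mult_index:
  assumes "matrix_rep G n \<rho>" "x \<in> carrier G" "y \<in> carrier G" "i < n" "j < n"
  shows "\<rho> (x \<otimes> y) $$ (i, j) = (\<Sum>p<n. \<rho> x $$ (i, p) * \<rho> y $$ (p, j))"
  using assms matrix_rep_carrier[OF assms(1)]
  by (simp add: matrix_rep_mult mult_mat_index_sum[of _ n n _ n])

lemma rep_extend_mult:
  assumes r: "matrix_rep G n \<rho>"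
  shows "rep_extend n \<rho> (ga_mult G a b) = rep_extend n \<rho> a * rep_extend n \<rho> b"
proof (rule eq_matI)
  fix i j
  assume "i < dim_row (rep_extend n \<rho> a * rep_extend n \<rho> b)"
    "j < dim_col (rep_extend n \<rho> a * rep_extend n \<rho> b)"
  hence ij: "i < n" "j < n" by (auto simp: rep_extend_def)
  have "rep_extend n \<rho> (ga_mult G a b) $$ (i, j) =
      (\<Sum>z\<in>carrier G. \<Sum>x\<in>carrier G. a x * b (inv x \<otimes> z) * \<rho> z $$ (i, j))"
    using ij by (simp add: rep_extend_def ga_mult_apply sum_distrib_right)
  also have "\<dots> = (\<Sum>x\<in>carrier G. \<Sum>z\<in>carrier G. a x * b (inv x \<otimes> z) * \<rho> z $$ (i, j))"
    by (rule sum.swap)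
  \<comment> \<open>Substitute z = x y in the inner sum.\<close>
  also have "\<dots> = (\<Sum>x\<in>carrier G. \<Sum>y\<in>carrier G. a x * b y * \<rho> (x \<otimes> y) $$ (i, j))"
  proof (rule sum.cong[OF refl])
    fix x assume x: "x \<in> carrier G"
    have "(\<Sum>z\<in>carrier G. a x * b (inv x \<otimes> z) * \<rho> z $$ (i, j)) =
        (\<Sum>y\<in>carrier G. a x * b (inv x \<otimes> (x \<otimes> y)) * \<rho> (x \<otimes> y) $$ (i, j))"
      by (rule sum_translate[OF x, symmetric])
    also have "\<dots> = (\<Sum>y\<in>carrier G. a x * b y * \<rho> (x \<otimes> y) $$ (i, j))"
      using x by (intro sum.cong) (auto simp: m_assoc[symmetric])
    finally show "(\<Sum>z\<in>carrier G. a x * b (inv x \<otimes> z) * \<rho> z $$ (i, j)) =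
      (\<Sum>y\<in>carrier G. a x * b y * \<rho> (x \<otimes> y) $$ (i, j))" .
  qed
  also have "\<dots> = (\<Sum>x\<in>carrier G. \<Sum>y\<in>carrier G. \<Sum>p<n. (a x * \<rho> x $$ (i, p)) * (b y * \<rho> y $$ (p, j)))"
    using r ij by (intro sum.cong refl) (simp add: matrix_rep_mult_index sum_distrib_left ac_simps)
  also have "\<dots> = (\<Sum>x\<in>carrier G. \<Sum>p<n. \<Sum>y\<in>carrier G. (a x * \<rho> x $$ (i, p)) * (b y * \<rho> y $$ (p, j)))"
    by (intro sum.cong refl sum.swap)
  also have "\<dots> = (\<Sum>p<n. \<Sum>x\<in>carrier G. \<Sum>y\<in>carrier G. (a x * \<rho> x $$ (i, p)) * (b y * \<rho> y $$ (p, j)))"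
    by (rule sum.swap)
  also have "\<dots> = (rep_extend n \<rho> a * rep_extend n \<rho> b) $$ (i, j)"
    unfolding mult_mat_index_sum[OF rep_extend_carrier rep_extend_carrier ij]
    using ij by (simp add: sum_product rep_extend_def)
  finally show "rep_extend n \<rho> (ga_mult G a b) $$ (i, j) =
    (rep_extend n \<rho> a * rep_extend n \<rho> b) $$ (i, j)" .
qed (auto simp: rep_extend_def)

lemma rep_extend_indicator:
  assumes r: "matrix_rep G n \<rho>" and g: "g \<in> carrier G"
  shows "rep_extend n \<rho> (indicator {g}) = \<rho> g"
proof (rule eq_matI)
  note c = matrix_rep_carrier[OF r g]
  fix i j assume "i < dim_row (\<rho> g)" "j < dim_col (\<rho> g)"
  hence ij: "i < n" "j < n" using c by auto
  have "(\<Sum>x\<in>carrier G. indicator {g} x * \<rho> x $$ (i, j)) =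
      (\<Sum>x\<in>carrier G. if x = g then \<rho> g $$ (i, j) else 0)"
    by (intro sum.cong) (auto simp: indicator_def)
  thus "rep_extend n \<rho> (indicator {g}) $$ (i, j) = \<rho> g $$ (i, j)"
    using ij g by (simp add: rep_extend_def)
qed (use matrix_rep_carrier[OF r g] in \<open>auto simp: rep_extend_def\<close>)

lemma rep_character_one:
  assumes "matrix_rep G n \<rho>"
  shows "rep_character G n \<rho> \<one> = of_nat n"
  using matrix_rep_one[OF is_group assms] by (simp add: rep_character_def)

lemma rep_character_commute:
  assumes r: "matrix_rep G n \<rho>" and "x \<in> carrier G" "y \<in> carrier G"
  shows "rep_character G n \<rho> (x \<otimes> y) = rep_character G n \<rho> (y \<otimes> x)"
  using assms matrix_rep_carrier[OF r] trace_mult_commute[of "\<rho> x" n n "\<rho> y"]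
  by (simp add: rep_character_def matrix_rep_mult)

text \<open>The matrix of a central element commutes with the whole representation, so Schur's lemma
  applies; the trace identifies the scalar.\<close>

lemma rep_extend_center:
  assumes \<rho>: "irreducible_rep G n \<rho>" and a: "a \<in> ga_center G"
  shows "rep_extend n \<rho> a = central_char (rep_character G n \<rho>) a \<cdot>\<^sub>m 1\<^sub>m n"
proof -
  have r: "matrix_rep G n \<rho>" and n: "n > 0" using \<rho> by (auto simp: irreducible_rep_def)
  have "\<exists>c. rep_extend n \<rho> a = c \<cdot>\<^sub>m 1\<^sub>m n"
  proof (rule schur_scalar[OF \<rho>])
    fix g assume g: "g \<in> carrier G"
    have "rep_extend n \<rho> (ga_mult G a (indicator {g})) = rep_extend n \<rho> (ga_mult G (indicator {g}) a)"
      using center_commute[OF a, of "indicator {g}"] g by simp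
    thus "\<rho> g * rep_extend n \<rho> a = rep_extend n \<rho> a * \<rho> g"
      using r g by (simp add: rep_extend_mult rep_extend_indicator)
  qed auto
  then obtain c where c: "rep_extend n \<rho> a = c \<cdot>\<^sub>m 1\<^sub>m n" by blast
  have "c * of_nat n = (\<Sum>i<n. rep_extend n \<rho> a $$ (i, i))" unfolding c by simp
  also have "\<dots> = (\<Sum>i<n. \<Sum>x\<in>carrier G. a x * \<rho> x $$ (i, i))" by (simp add: rep_extend_def)
  also have "\<dots> = (\<Sum>x\<in>carrier G. a x * rep_character G n \<rho> x)"
    by (subst sum.swap) (simp add: rep_character_def sum_distrib_left)
  finally have "c = central_char (rep_character G n \<rho>) a"
    using n by (simp add: central_char_def rep_character_one[OF r] field_simps)
  thus ?thesis using c by simp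
qed

lemma Irr_one_nonzero: "\<psi> \<in> Irr G \<Longrightarrow> \<psi> \<one> \<noteq> 0"
  by (auto simp: Irr_def irreducible_rep_def rep_character_one)

lemma Irr_one_positive:
  assumes "\<psi> \<in> Irr G"
  obtains n :: nat where "n > 0" "\<psi> \<one> = of_nat n"
  using assms by (auto simp: Irr_def irreducible_rep_def rep_character_one)

lemma central_char_add: "central_char \<psi> (a + b) = central_char \<psi> a + central_char \<psi> b"
  by (simp add: central_char_def sum.distrib algebra_simps add_divide_distrib)

lemma central_char_scale: "central_char \<psi> (\<lambda>x. c * a x) = c * central_char \<psi> a"
  by (simp add: central_char_def sum_distrib_left algebra_simps)

lemma central_char_sum: "central_char \<psi> (\<Sum>i\<in>I. f i) = (\<Sum>i\<in>I. central_char \<psi> (f i))"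
  unfolding central_char_def sum_fun_apply sum_distrib_right sum_divide_distrib
  by (rule sum.swap)

lemma central_char_zero [simp]: "central_char \<psi> 0 = 0"
  by (simp add: central_char_def)

lemma central_char_one: 
  assumes "\<psi> \<in> Irr G"
  shows "central_char \<psi> (indicator {\<one>}) = 1"
proof -
  have "(\<Sum>x\<in>carrier G. indicator {\<one>} x * \<psi> x) = (\<Sum>x\<in>carrier G. if x = \<one> then \<psi> \<one> else 0)"
    by (intro sum.cong) (auto simp: indicator_def)
  thus ?thesis using Irr_one_nonzero[OF assms] by (simp add: central_char_def)
qed

text \<open>All three elements act by scalar matrices, and \<open>rep_extend\<close> is
  multiplicative. The scalars are compared at entry (0, 0), which exists because the degree is
  positive.\<close>

lemma central_char_mult:
  assumes \<psi>: "\<psi> \<in> Irr G" and a: "a \<in> ga_center G" and b: "b \<in> ga_center G"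
    and ab: "ga_mult G a b \<in> ga_center G"
  shows "central_char \<psi> (ga_mult G a b) = central_char \<psi> a * central_char \<psi> b"
proof -
  from \<psi> obtain n \<rho> where \<rho>: "irreducible_rep G n \<rho>" and p: "\<psi> = rep_character G n \<rho>"
    by (auto simp: Irr_def)
  hence r: "matrix_rep G n \<rho>" and n: "n > 0" by (auto simp: irreducible_rep_def)
  have "central_char \<psi> (ga_mult G a b) = rep_extend n \<rho> (ga_mult G a b) $$ (0, 0)"
    using n by (simp add: rep_extend_center[OF \<rho> ab] p)
  also have "\<dots> = ((central_char \<psi> a \<cdot>\<^sub>m 1\<^sub>m n) * (central_char \<psi> b \<cdot>\<^sub>m 1\<^sub>m n)) $$ (0, 0)"
    by (simp add: rep_extend_mult[OF r] rep_extend_center[OF \<rho> a] rep_extend_center[OF \<rho> b] p)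
  also have "\<dots> = central_char \<psi> a * central_char \<psi> b"
    using n by (simp add: mult_smult_assoc_mat[of _ n n _ n])
  finally show ?thesis .
qed

lemma center_mult:
  assumes a: "a \<in> ga_center G" and b: "b \<in> ga_center G"
  shows "ga_mult G a b \<in> ga_center G"
proof -
  have "ga_mult G (ga_mult G a b) c = ga_mult G c (ga_mult G a b)" if c: "c \<in> group_algebra G" for c
  proof -
    have "ga_mult G (ga_mult G a b) c = ga_mult G a (ga_mult G c b)"
      by (simp add: ga_mult_assoc center_commute[OF b c])
    also have "\<dots> = ga_mult G c (ga_mult G a b)"
      using center_commute[OF a c] by (simp add: ga_mult_assoc[symmetric])
    finally show ?thesis .
  qed
  thus ?thesis by (simp add: ga_center_def)
qed

lemma center_subspace: "cfun.subspace (ga_center G)"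
  unfolding cfun.subspace_def
proof (intro conjI ballI allI)
  show "0 \<in> ga_center G"
    using cfun.subspace_0[OF group_algebra_subspace] by (simp add: center_iff_class_function)
  fix a b :: "'a \<Rightarrow> complex" and c :: complex assume a: "a \<in> ga_center G"
  show "(\<lambda>x. c * a x) \<in> ga_center G"
    using a cfun.subspace_scale[OF group_algebra_subspace, of a c]
    by (simp add: center_iff_class_function)
  assume b: "b \<in> ga_center G"
  show "a + b \<in> ga_center G"
    using a b cfun.subspace_add[OF group_algebra_subspace, of a b]
    by (simp add: center_iff_class_function)
qed

lemma char_idempotent_center:
  assumes "\<psi> \<in> Irr G"
  shows "char_idempotent G \<psi> \<in> ga_center G"
  using assms
  by (auto simp: center_iff_class_function group_algebra_def char_idempotent_def Irr_def
      irreducible_rep_def inv_mult_group rep_character_commute)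

subsection \<open>Orthogonality relations\<close>

text \<open>\<open>A\<close> is the group average of \<rho>(x) E \<rho>'(inv x), where E is the
  matrix unit at position (j, k); averaging any matrix this way produces an intertwiner.\<close>

lemma schur_average:
  fixes \<rho> \<rho>' n m j k
  defines "A \<equiv> mat n m (\<lambda>(i, l). \<Sum>x\<in>carrier G. \<rho> x $$ (i, j) * \<rho>' (inv x) $$ (k, l))"
  assumes r: "matrix_rep G n \<rho>" and r': "matrix_rep G m \<rho>'"
    and j: "j < n" and k: "k < m" and g: "g \<in> carrier G"
  shows "\<rho> g * A = A * \<rho>' g"
proof (rule eq_matI)
  note c = matrix_rep_carrier[OF r] and c' = matrix_rep_carrier[OF r']
  have A: "A \<in> carrier_mat n m" by (simp add: A_def)
  have A_index: "A $$ (p, q) = (\<Sum>x\<in>carrier G. \<rho> x $$ (p, j) * \<rho>' (inv x) $$ (k, q))"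
    if "p < n" "q < m" for p q using that by (simp add: A_def)
  fix i l assume "i < dim_row (A * \<rho>' g)" "l < dim_col (A * \<rho>' g)"
  hence il: "i < n" "l < m" using c'[OF g] A by auto
  have "(\<rho> g * A) $$ (i, l) = (\<Sum>p<n. \<Sum>x\<in>carrier G. \<rho> g $$ (i, p) * (\<rho> x $$ (p, j) * \<rho>' (inv x) $$ (k, l)))"
    using il by (simp add: mult_mat_index_sum[OF c[OF g] A] A_index sum_distrib_left)
  also have "\<dots> = (\<Sum>x\<in>carrier G. \<rho> (g \<otimes> x) $$ (i, j) * \<rho>' (inv x) $$ (k, l))"
    using il j by (subst sum.swap) (auto intro!: sum.cong
        simp: matrix_rep_mult_index[OF r g] sum_distrib_right mult.assoc)
  \<comment> \<open>Write \<open>inv x\<close> as the inverse of g x, times g: now x occurs only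
    through g x, and translation by g removes the g.\<close>
  also have "\<dots> = (\<Sum>x\<in>carrier G. \<rho> (g \<otimes> x) $$ (i, j) * \<rho>' (inv (g \<otimes> x) \<otimes> g) $$ (k, l))"
    using g by (intro sum.cong) (auto simp: inv_mult_group m_assoc)
  also have "\<dots> = (\<Sum>x\<in>carrier G. \<rho> x $$ (i, j) * \<rho>' (inv x \<otimes> g) $$ (k, l))"
    by (rule sum_translate[OF g])
  also have "\<dots> = (\<Sum>p<m. \<Sum>x\<in>carrier G. (\<rho> x $$ (i, j) * \<rho>' (inv x) $$ (k, p)) * \<rho>' g $$ (p, l))"
    using il k g by (subst sum.swap) (auto intro!: sum.cong
        simp: matrix_rep_mult_index[OF r' _ g] sum_distrib_left mult.assoc)
  also have "\<dots> = (A * \<rho>' g) $$ (i, l)"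
    using il by (simp add: mult_mat_index_sum[OF A c'[OF g]] A_index sum_distrib_right)
  finally show "(\<rho> g * A) $$ (i, l) = (A * \<rho>' g) $$ (i, l)" .
qed (use matrix_rep_carrier[OF r g] matrix_rep_carrier[OF r' g] in \<open>auto simp: A_def\<close>)

text \<open>Different characters admit no nonzero intertwiner, so the average of every matrix unit
  vanishes; the sum is its entry (i, l).\<close>

lemma schur_orthogonality_distinct:
  assumes \<rho>: "irreducible_rep G n \<rho>" and \<rho>': "irreducible_rep G m \<rho>'"
    and ne: "rep_character G n \<rho> \<noteq> rep_character G m \<rho>'"
    and ijkl: "i < n" "j < n" "k < m" "l < m"
  shows "(\<Sum>x\<in>carrier G. \<rho> x $$ (i, j) * \<rho>' (inv x) $$ (k, l)) = 0"
proof -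
  let ?A = "mat n m (\<lambda>(i, l). \<Sum>x\<in>carrier G. \<rho> x $$ (i, j) * \<rho>' (inv x) $$ (k, l))"
  have r: "matrix_rep G n \<rho>" and r': "matrix_rep G m \<rho>'"
    using \<rho> \<rho>' by (auto simp: irreducible_rep_def)
  have "?A = 0\<^sub>m n m"
    using schur_intertwiner[OF \<rho> \<rho>', of ?A] schur_average[OF r r' ijkl(2,3)] ne by auto
  hence "?A $$ (i, l) = 0" using ijkl by simp
  thus ?thesis using ijkl by simp
qed

text \<open>Here the average of the matrix unit at (j, k) is a scalar matrix, and its trace
  collapses to an entry of \<rho> at the unit element, summed over the group.\<close>

lemma schur_orthogonality_same:
  assumes \<rho>: "irreducible_rep G n \<rho>" and ijkl: "i < n" "j < n" "k < n" "l < n"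
  shows "(\<Sum>x\<in>carrier G. \<rho> x $$ (i, j) * \<rho> (inv x) $$ (k, l)) =
    (if i = l \<and> j = k then of_nat (card (carrier G)) / of_nat n else 0)"
proof -
  let ?A = "mat n n (\<lambda>(i, l). \<Sum>x\<in>carrier G. \<rho> x $$ (i, j) * \<rho> (inv x) $$ (k, l))"
  have r: "matrix_rep G n \<rho>" using \<rho> by (auto simp: irreducible_rep_def)
  obtain c where c: "?A = c \<cdot>\<^sub>m 1\<^sub>m n"
    using schur_scalar[OF \<rho>, of ?A] schur_average[OF r r ijkl(2,3)] by auto
  have "c * of_nat n = (\<Sum>i<n. ?A $$ (i, i))" unfolding c by simp
  also have "\<dots> = (\<Sum>i<n. \<Sum>x\<in>carrier G. \<rho> x $$ (i, j) * \<rho> (inv x) $$ (k, i))" by simp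
  also have "\<dots> = (\<Sum>x\<in>carrier G. \<Sum>i<n. \<rho> (inv x) $$ (k, i) * \<rho> x $$ (i, j))"
    by (subst sum.swap) (simp add: mult.commute)
  also have "\<dots> = (\<Sum>x\<in>carrier G. \<rho> (inv x \<otimes> x) $$ (k, j))"
    using ijkl by (intro sum.cong refl matrix_rep_mult_index[OF r, symmetric]) auto
  also have "\<dots> = (if j = k then of_nat (card (carrier G)) else 0)"
    using ijkl matrix_rep_one[OF is_group r] by simp
  finally have "c = (if j = k then of_nat (card (carrier G)) / of_nat n else 0)"
    using ijkl by (auto simp: field_simps split: if_splits)
  moreover have "?A $$ (i, l) = (if i = l then c else 0)" unfolding c using ijkl by simp
  ultimately show ?thesis using ijkl by simp
qed

text \<open>Up to the factor \<psi>(1) / (|G| \<phi>(1)) the value is the sum \<open>T\<close>, to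
  which the orthogonality relations for matrix entries apply.\<close>

lemma central_char_idempotent:
  assumes \<psi>: "\<psi> \<in> Irr G" and \<phi>: "\<phi> \<in> Irr G"
  shows "central_char \<phi> (char_idempotent G \<psi>) = (if \<phi> = \<psi> then 1 else 0)"
proof -
  from \<phi> obtain n \<rho> where \<rho>: "irreducible_rep G n \<rho>" and p: "\<phi> = rep_character G n \<rho>"
    by (auto simp: Irr_def)
  from \<psi> obtain m \<rho>' where \<rho>': "irreducible_rep G m \<rho>'" and p': "\<psi> = rep_character G m \<rho>'"
    by (auto simp: Irr_def)
  have n: "n > 0" and r: "matrix_rep G n \<rho>" using \<rho> by (auto simp: irreducible_rep_def)
  have ord: "card (carrier G) \<noteq> 0" by (auto simp:)
  define T where "T = (\<Sum>x\<in>carrier G. \<phi> x * \<psi> (inv x))"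
  have idem: "central_char \<phi> (char_idempotent G \<psi>) = \<psi> \<one> / of_nat (card (carrier G)) * T / \<phi> \<one>"
    unfolding central_char_def T_def sum_distrib_left
    by (simp add: char_idempotent_def ac_simps)
  show ?thesis
  proof (cases "\<phi> = \<psi>")
    case False
    have "T = (\<Sum>x\<in>carrier G. \<Sum>i<n. \<Sum>k<m. \<rho> x $$ (i, i) * \<rho>' (inv x) $$ (k, k))"
      by (simp add: T_def p p' rep_character_def sum_product)
    also have "\<dots> = (\<Sum>i<n. \<Sum>x\<in>carrier G. \<Sum>k<m. \<rho> x $$ (i, i) * \<rho>' (inv x) $$ (k, k))"
      by (rule sum.swap)
    also have "\<dots> = (\<Sum>i<n. \<Sum>k<m. \<Sum>x\<in>carrier G. \<rho> x $$ (i, i) * \<rho>' (inv x) $$ (k, k))"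
      by (intro sum.cong refl sum.swap)
    also have "\<dots> = 0"
      using False p p' by (intro sum.neutral ballI schur_orthogonality_distinct[OF \<rho> \<rho>']) auto
    finally show ?thesis using False idem by simp
  next
    case True
    have "T = (\<Sum>x\<in>carrier G. \<Sum>i<n. \<Sum>k<n. \<rho> x $$ (i, i) * \<rho> (inv x) $$ (k, k))"
      by (simp add: T_def True[symmetric] p rep_character_def sum_product)
    also have "\<dots> = (\<Sum>i<n. \<Sum>x\<in>carrier G. \<Sum>k<n. \<rho> x $$ (i, i) * \<rho> (inv x) $$ (k, k))"
      by (rule sum.swap)
    also have "\<dots> = (\<Sum>i<n. \<Sum>k<n. \<Sum>x\<in>carrier G. \<rho> x $$ (i, i) * \<rho> (inv x) $$ (k, k))"
      by (intro sum.cong refl sum.swap)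
    \<comment> \<open>Only the n diagonal pairs i = k survive, each contributing |G| / n.\<close>
    also have "\<dots> = (\<Sum>i<n. \<Sum>k<n. if i = k then of_nat (card (carrier G)) / of_nat n else 0)"
      by (intro sum.cong refl) (simp add: schur_orthogonality_same[OF \<rho>])
    also have "\<dots> = of_nat (card (carrier G))" using n by simp
    finally show ?thesis using True idem ord Irr_one_nonzero[OF \<phi>] by simp
  qed
qed

end

section \<open>Central elements are separated by irreducible representations\<close>

text \<open>\<open>cfun.independent\<close> speaks of sets of vectors while coordinates are indexed
  by numbers; injectivity of \<open>b\<close> allows \<open>the_inv_into\<close> to pass from one to
  the other.\<close>

lemma lincomb_eq_iff:
  fixes b :: "nat \<Rightarrow> 'a \<Rightarrow> complex"
  assumes ind: "cfun.independent (b ` {..<k})" and inj: "inj_on b {..<k}"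
  shows "(\<lambda>x. \<Sum>i<k. u i * b i x) = (\<lambda>x. \<Sum>i<k. v i * b i x) \<longleftrightarrow> (\<forall>i<k. u i = v i)"
proof
  assume eq: "(\<lambda>x. \<Sum>i<k. u i * b i x) = (\<lambda>x. \<Sum>i<k. v i * b i x)"
  let ?c = "\<lambda>w. u (the_inv_into {..<k} b w) - v (the_inv_into {..<k} b w)"
  have "(\<Sum>w\<in>b ` {..<k}. (\<lambda>x. ?c w * w x)) = 0"
  proof
    fix x
    have "(\<Sum>w\<in>b ` {..<k}. ?c w * w x) = (\<Sum>i<k. (u i - v i) * b i x)"
      using inj by (subst sum.reindex) (auto intro!: sum.cong simp: the_inv_into_f_f)
    also have "\<dots> = 0" using fun_cong[OF eq, of x] by (simp add: algebra_simps sum_subtractf)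
    finally show "(\<Sum>w\<in>b ` {..<k}. (\<lambda>x. ?c w * w x)) x = 0 x" by (simp add: sum_fun_apply)
  qed
  hence "?c (b i) = 0" if "i < k" for i
    using cfun.independentD[OF ind, of "b ` {..<k}" ?c "b i"] that by auto
  thus "\<forall>i<k. u i = v i" using inj by (auto simp: the_inv_into_f_f)
qed auto

lemma span_lincomb:
  fixes b :: "nat \<Rightarrow> 'a \<Rightarrow> complex"
  assumes inj: "inj_on b {..<k}"
  shows "w \<in> cfun.span (b ` {..<k}) \<longleftrightarrow> (\<exists>u. w = (\<lambda>x. \<Sum>i<k. u i * b i x))"
proof
  assume "w \<in> cfun.span (b ` {..<k})"
  then obtain c where "w = (\<Sum>v\<in>b ` {..<k}. (\<lambda>x. c v * v x))"
    by (auto simp: cfun.span_finite)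
  also have "\<dots> = (\<lambda>x. \<Sum>i<k. c (b i) * b i x)"
    using inj by (auto simp: fun_eq_iff sum_fun_apply sum.reindex)
  finally show "\<exists>u. w = (\<lambda>x. \<Sum>i<k. u i * b i x)" by (intro exI[of _ "\<lambda>i. c (b i)"])
next
  assume "\<exists>u. w = (\<lambda>x. \<Sum>i<k. u i * b i x)"
  then obtain u where "w = (\<lambda>x. \<Sum>i<k. u i * b i x)" ..
  also have "\<dots> = (\<Sum>i<k. (\<lambda>x. u i * b i x))" by (auto simp: fun_eq_iff sum_fun_apply)
  also have "\<dots> \<in> cfun.span (b ` {..<k})"
    by (intro cfun.span_sum cfun.span_scale cfun.span_base) auto
  finally show "w \<in> cfun.span (b ` {..<k})" .
qed

context finite_group
begin

lemma ga_mult_lincomb: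
  "ga_mult G a (\<lambda>x. \<Sum>i\<in>I. u i * f i x) = (\<lambda>x. \<Sum>i\<in>I. u i * ga_mult G a (f i) x)"
  unfolding ga_mult_def
  by (auto simp: fun_eq_iff sum_distrib_left mult.left_commute intro: sum.swap)

text \<open>Expanding \<open>a\<close> in group elements reduces left multiplication to
  translations, so that translation-invariant subspaces are left ideals.\<close>

lemma ga_mult_as_translates:
  "ga_mult G a w x = (\<Sum>g\<in>carrier G. a g * ga_mult G (indicator {g}) w x)"
  by (cases "x \<in> carrier G") (simp_all add: ga_mult_apply ga_mult_indicator_left, simp add: ga_mult_def)

lemma ga_mult_indicators:
  assumes "g \<in> carrier G" "h \<in> carrier G"
  shows "ga_mult G (indicator {g}) (indicator {h}) = indicator {g \<otimes> h}"
proof (rule group_algebra_eqI)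
  fix x assume "x \<in> carrier G"
  thus "ga_mult G (indicator {g}) (indicator {h}) x = indicator {g \<otimes> h} x"
    using assms by (auto simp: ga_mult_indicator_left indicator_def m_assoc[symmetric])
qed (use assms in auto)

text \<open>Coordinates with respect to \<open>b\<close> turn the left translations into matrices.
  Extending linearly, \<open>rep_extend\<close> of \<open>c\<close> is then the coordinate matrix of
  left multiplication by \<open>c\<close>.\<close>

lemma left_invariant_rep:
  fixes b :: "nat \<Rightarrow> 'a \<Rightarrow> complex"
  assumes ind: "cfun.independent (b ` {..<k})" and inj: "inj_on b {..<k}"
    and ga: "cfun.span (b ` {..<k}) \<subseteq> group_algebra G"
    and inv: "\<And>g w. g \<in> carrier G \<Longrightarrow> w \<in> cfun.span (b ` {..<k}) \<Longrightarrow>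
      ga_mult G (indicator {g}) w \<in> cfun.span (b ` {..<k})"
  obtains \<rho> where "matrix_rep G k \<rho>"
    and "\<And>c u. ga_mult G c (\<lambda>x. \<Sum>j<k. u j * b j x) =
      (\<lambda>x. \<Sum>i<k. (\<Sum>j<k. rep_extend k \<rho> c $$ (i, j) * u j) * b i x)"
proof -
  have base: "b j \<in> cfun.span (b ` {..<k})" if "j < k" for j
    using that by (intro cfun.span_base) auto
  have "\<forall>w\<in>cfun.span (b ` {..<k}). \<exists>u. w = (\<lambda>x. \<Sum>i<k. u i * b i x)"
    using span_lincomb[OF inj] by blast
  then obtain co where co: "\<And>w. w \<in> cfun.span (b ` {..<k}) \<Longrightarrow> w = (\<lambda>x. \<Sum>i<k. co w i * b i x)"
    by metis
  define \<rho> where "\<rho> g = mat k k (\<lambda>(i, j). co (ga_mult G (indicator {g}) (b j)) i)" for g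
  have act: "ga_mult G (indicator {g}) (b j) = (\<lambda>x. \<Sum>i<k. \<rho> g $$ (i, j) * b i x)"
    if "g \<in> carrier G" "j < k" for g j
    using co[OF inv[OF that(1) base[OF that(2)]]] that by (simp add: \<rho>_def)
  have lin: "(\<lambda>x. \<Sum>j<k. u j * (\<Sum>i<k. M i j * b i x)) = (\<lambda>x. \<Sum>i<k. (\<Sum>j<k. M i j * u j) * b i x)"
    for u :: "nat \<Rightarrow> complex" and M :: "nat \<Rightarrow> nat \<Rightarrow> complex"
    by (auto simp: fun_eq_iff sum_distrib_left sum_distrib_right ac_simps intro: sum.swap)
  have actl: "ga_mult G (indicator {g}) (\<lambda>x. \<Sum>j<k. u j * b j x) =
      (\<lambda>x. \<Sum>i<k. (\<Sum>j<k. \<rho> g $$ (i, j) * u j) * b i x)" if "g \<in> carrier G" for g u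
    unfolding ga_mult_lincomb lin[symmetric] using act[OF that] by (auto intro!: sum.cong)
  have [simp]: "\<rho> g \<in> carrier_mat k k" for g by (simp add: \<rho>_def)
  have r: "matrix_rep G k \<rho>"
  proof (rule matrix_repI[OF is_group])
    fix g h assume g: "g \<in> carrier G" and h: "h \<in> carrier G"
    show "\<rho> (g \<otimes> h) = \<rho> g * \<rho> h"
    proof (rule eq_matI)
      fix i j assume "i < dim_row (\<rho> g * \<rho> h)" "j < dim_col (\<rho> g * \<rho> h)"
      hence ij: "i < k" "j < k" by (auto simp: \<rho>_def)
      have "(\<lambda>x. \<Sum>i<k. \<rho> (g \<otimes> h) $$ (i, j) * b i x) = ga_mult G (indicator {g \<otimes> h}) (b j)"
        using act[of "g \<otimes> h" j] g h ij by simp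
      also have "\<dots> = ga_mult G (indicator {g}) (ga_mult G (indicator {h}) (b j))"
        using g h by (simp add: ga_mult_indicators ga_mult_assoc[symmetric])
      also have "\<dots> = (\<lambda>x. \<Sum>i<k. (\<Sum>p<k. \<rho> g $$ (i, p) * \<rho> h $$ (p, j)) * b i x)"
        unfolding act[OF h ij(2)] by (rule actl[OF g])
      finally show "\<rho> (g \<otimes> h) $$ (i, j) = (\<rho> g * \<rho> h) $$ (i, j)"
        using ij by (subst mult_mat_index_sum[of _ k k _ k]) (auto simp: lincomb_eq_iff[OF ind inj])
    qed (auto simp: \<rho>_def)
  next
    show "\<rho> \<one> = 1\<^sub>m k"
    proof (rule eq_matI)
      fix i j assume "i < dim_row (1\<^sub>m k :: complex mat)" "j < dim_col (1\<^sub>m k :: complex mat)"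
      hence ij: "i < k" "j < k" by auto
      \<comment> \<open>Convolution with the unit truncates functions to the carrier, so it fixes
        \<open>b j\<close> because \<open>b j\<close> vanishes outside the carrier.\<close>
      have "b j \<in> group_algebra G" using base[OF ij(2)] ga by blast
      hence "(\<lambda>x. \<Sum>i<k. \<rho> \<one> $$ (i, j) * b i x) = b j"
        using act[of \<one> j] ij by (simp add: ga_mult_one_left)
      also have "b j = (\<lambda>x. \<Sum>i<k. (if i = j then 1 else 0) * b i x)"
        using ij by (auto simp: fun_eq_iff if_distrib[of "\<lambda>z. z * _"] cong: if_cong)
      finally show "\<rho> \<one> $$ (i, j) = 1\<^sub>m k $$ (i, j)"
        unfolding lincomb_eq_iff[OF ind inj] using ij by simp
    qed (auto simp: \<rho>_def)
  qed auto
  have "ga_mult G c (\<lambda>x. \<Sum>j<k. u j * b j x) =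
      (\<lambda>x. \<Sum>i<k. (\<Sum>j<k. rep_extend k \<rho> c $$ (i, j) * u j) * b i x)" for c u
  proof
    fix x
    have "ga_mult G c (\<lambda>x. \<Sum>j<k. u j * b j x) x =
        (\<Sum>g\<in>carrier G. c g * (\<Sum>i<k. (\<Sum>j<k. \<rho> g $$ (i, j) * u j) * b i x))"
      by (subst ga_mult_as_translates) (auto intro!: sum.cong simp: actl)
    also have "\<dots> = (\<Sum>g\<in>carrier G. \<Sum>i<k. \<Sum>j<k. c g * \<rho> g $$ (i, j) * u j * b i x)"
      by (simp add: sum_distrib_left sum_distrib_right mult.assoc)
    also have "\<dots> = (\<Sum>i<k. \<Sum>g\<in>carrier G. \<Sum>j<k. c g * \<rho> g $$ (i, j) * u j * b i x)"
      by (rule sum.swap)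
    also have "\<dots> = (\<Sum>i<k. \<Sum>j<k. \<Sum>g\<in>carrier G. c g * \<rho> g $$ (i, j) * u j * b i x)"
      by (intro sum.cong[OF refl] sum.swap)
    also have "\<dots> = (\<Sum>i<k. (\<Sum>j<k. rep_extend k \<rho> c $$ (i, j) * u j) * b i x)"
      by (intro sum.cong refl) (simp add: rep_extend_def sum_distrib_right)
    finally show "ga_mult G c (\<lambda>x. \<Sum>j<k. u j * b j x) x =
      (\<Sum>i<k. (\<Sum>j<k. rep_extend k \<rho> c $$ (i, j) * u j) * b i x)" .
  qed
  thus thesis using r that by blast
qed

text \<open>These are the left ideals of the group algebra; closure under translations is what
  representations and coordinates see directly.\<close>

definition left_invariant :: "('a \<Rightarrow> complex) set \<Rightarrow> bool" where
  "left_invariant W \<longleftrightarrow> cfun.subspace W \<and> W \<subseteq> group_algebra G \<and>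
     (\<forall>g\<in>carrier G. \<forall>w\<in>W. ga_mult G (indicator {g}) w \<in> W)"

text \<open>A nonzero left ideal of least dimension inside \<open>V\<close> is minimal.\<close>

lemma ex_minimal_left_invariant:
  assumes V: "left_invariant V" "V \<noteq> {0}"
  shows "\<exists>W. left_invariant W \<and> W \<subseteq> V \<and> W \<noteq> {0} \<and>
    (\<forall>W'. left_invariant W' \<longrightarrow> W' \<subseteq> W \<longrightarrow> W' = {0} \<or> W' = W)"
proof -
  let ?Q = "\<lambda>W. left_invariant W \<and> W \<subseteq> V \<and> W \<noteq> {0}"
  from V have "?Q V" by simp
  from ex_has_least_nat[of ?Q, OF this, of cfun.dim]
  obtain W where W: "?Q W" and min: "\<And>W'. ?Q W' \<Longrightarrow> cfun.dim W \<le> cfun.dim W'" by blast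
  have eq: "W' = W" if W': "left_invariant W'" "W' \<subseteq> W" "W' \<noteq> {0}" for W'
  proof -
    obtain B' where B': "B' \<subseteq> W'" "cfun.independent B'" "W' \<subseteq> cfun.span B'" "card B' = cfun.dim W'"
      using cfun.basis_exists by blast
    have "B' \<subseteq> W" using B' W' by blast
    from cfun.maximal_independent_subset_extend[OF this B'(2)]
    obtain B where B: "B' \<subseteq> B" "B \<subseteq> W" "cfun.independent B" "W \<subseteq> cfun.span B" by blast
    have fin: "finite B" using B W by (intro independent_finite) (auto simp: left_invariant_def)
    \<comment> \<open>The basis \<open>B'\<close> of the smaller ideal was extended to a basis
      \<open>B\<close> of \<open>W\<close>; least dimension leaves no room for an extension.\<close>
    have "card B = cfun.dim W" using B by (metis cfun.basis_card_eq_dim)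
    also have "\<dots> \<le> card B'" using min[of W'] W' W B'(4) by auto
    finally have "B' = B" using B(1) fin by (intro card_seteq) auto
    hence "W \<subseteq> cfun.span B'" using B by simp
    also have "\<dots> \<subseteq> W'" using B' W' by (intro cfun.span_minimal) (auto simp: left_invariant_def)
    finally show "W' = W" using W' by blast
  qed
  show ?thesis
  proof (intro exI[of _ W] conjI allI impI)
    show "W' = {0} \<or> W' = W" if "left_invariant W'" "W' \<subseteq> W" for W'
      using eq[OF that] by (cases "W' = {0}") simp_all
  qed (use W in simp_all)
qed

text \<open>The map \<open>lc\<close> from coordinate vectors to the ideal is injective and
  intertwines \<rho> with translation. It carries invariant subspaces to left ideals inside the
  minimal one, so only the two extremes remain.\<close>

lemma minimal_left_invariant_irreducible:
  fixes b :: "nat \<Rightarrow> 'a \<Rightarrow> complex"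
  assumes ind: "cfun.independent (b ` {..<k})" and inj: "inj_on b {..<k}"
    and W: "left_invariant (cfun.span (b ` {..<k}))" and k: "k > 0"
    and min: "\<And>W'. left_invariant W' \<Longrightarrow> W' \<subseteq> cfun.span (b ` {..<k}) \<Longrightarrow>
      W' = {0} \<or> W' = cfun.span (b ` {..<k})"
    and r: "matrix_rep G k \<rho>"
    and act: "\<And>c u. ga_mult G c (\<lambda>x. \<Sum>j<k. u j * b j x) =
      (\<lambda>x. \<Sum>i<k. (\<Sum>j<k. rep_extend k \<rho> c $$ (i, j) * u j) * b i x)"
  shows "irreducible_rep G k \<rho>"
proof -
  define lc where "lc u = (\<lambda>x. \<Sum>i<k. u $ i * b i x)" for u :: "complex vec"
  have lc_eq: "u = v" if "lc u = lc v" "u \<in> carrier_vec k" "v \<in> carrier_vec k" for u v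
    using that unfolding lc_def lincomb_eq_iff[OF ind inj] by (auto intro!: eq_vecI)
  have lc_zero: "lc (0\<^sub>v k) = 0" by (simp add: lc_def fun_eq_iff)
  have lc_span: "lc u \<in> cfun.span (b ` {..<k})" for u
    unfolding span_lincomb[OF inj] lc_def by (rule exI[of _ "($) u"]) (rule refl)
  have inv: "U = {0\<^sub>v k} \<or> U = carrier_vec k"
    if U: "U \<subseteq> carrier_vec k" "0\<^sub>v k \<in> U" "\<And>v w. v \<in> U \<Longrightarrow> w \<in> U \<Longrightarrow> v + w \<in> U"
      "\<And>c v. v \<in> U \<Longrightarrow> c \<cdot>\<^sub>v v \<in> U" "\<And>g w. g \<in> carrier G \<Longrightarrow> w \<in> U \<Longrightarrow> \<rho> g *\<^sub>v w \<in> U" for U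
  proof -
    have sub: "lc ` U \<subseteq> cfun.span (b ` {..<k})" using lc_span by blast
    have "left_invariant (lc ` U)"
      unfolding left_invariant_def cfun.subspace_def
    proof (intro conjI ballI allI)
      show "0 \<in> lc ` U" using U(2) lc_zero by (metis imageI)
      show "lc ` U \<subseteq> group_algebra G" using sub W by (auto simp: left_invariant_def)
    next
      fix f h assume "f \<in> lc ` U" "h \<in> lc ` U"
      then obtain u v where uv: "f = lc u" "h = lc v" "u \<in> U" "v \<in> U" by blast
      have "lc u + lc v = lc (u + v)"
        using uv U(1) by (auto simp: lc_def fun_eq_iff algebra_simps sum.distrib subset_iff)
      thus "f + h \<in> lc ` U" using uv U(3) by blast
    next
      fix f c assume "f \<in> lc ` U"
      then obtain u where u: "f = lc u" "u \<in> U" by blast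
      have "(\<lambda>x. c * lc u x) = lc (c \<cdot>\<^sub>v u)"
        using u U(1) by (auto simp: lc_def fun_eq_iff sum_distrib_left mult.assoc subset_iff)
      thus "(\<lambda>x. c * f x) \<in> lc ` U" using u U(4) by blast
    next
      fix f g assume "f \<in> lc ` U" and g: "g \<in> carrier G"
      then obtain u where u: "f = lc u" "u \<in> U" by blast
      have "ga_mult G (indicator {g}) (lc u) = lc (\<rho> g *\<^sub>v u)"
        unfolding lc_def act rep_extend_indicator[OF r g]
        using mult_mat_vec_index_sum[OF matrix_rep_carrier[OF r g], of u] u U(1)
        by (intro ext sum.cong refl) (auto simp del: index_mult_mat_vec)
      thus "ga_mult G (indicator {g}) f \<in> lc ` U" using u U(5)[OF g] by blast
    qed
    from min[OF this sub] show ?thesis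
    proof
      assume "lc ` U = {0}"
      hence "u = 0\<^sub>v k" if "u \<in> U" for u
        using that lc_eq[of u "0\<^sub>v k"] U(1) lc_zero by auto
      thus ?thesis using U(2) by blast
    next
      assume eq: "lc ` U = cfun.span (b ` {..<k})"
      have "v \<in> U" if v: "v \<in> carrier_vec k" for v
      proof -
        from lc_span[of v] obtain u where "u \<in> U" "lc v = lc u" unfolding eq[symmetric] by blast
        thus ?thesis using lc_eq[of v u] v U(1) by blast
      qed
      thus ?thesis using U(1) by blast
    qed
  qed
  show ?thesis
    unfolding irreducible_rep_def vec_subspace_iff
    by (intro conjI allI impI r k; (elim conjE)?) (rule inv; simp)
qed

text \<open>The left ideal generated by \<open>a\<close> contains a minimal one, which affords an
  irreducible character. If its central character killed \<open>a\<close>, then \<open>a\<close>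
  would annihilate that minimal ideal.\<close>

lemma central_char_separates:
  assumes a: "a \<in> ga_center G" and nz: "a \<noteq> 0"
  shows "\<exists>\<psi>\<in>Irr G. central_char \<psi> a \<noteq> 0"
proof -
  let ?V = "ga_mult G a ` group_algebra G"
  have V: "left_invariant ?V"
    unfolding left_invariant_def cfun.subspace_def
  proof (intro conjI ballI allI)
    show "0 \<in> ?V"
      by (rule image_eqI[of _ _ 0]) (auto simp: cfun.subspace_0[OF group_algebra_subspace])
  next
    fix f h assume "f \<in> ?V" "h \<in> ?V"
    thus "f + h \<in> ?V"
      by (auto simp: ga_mult_add_right[symmetric] cfun.subspace_add[OF group_algebra_subspace])
  next
    fix f c assume "f \<in> ?V"
    thus "(\<lambda>x. c * f x) \<in> ?V"
      by (auto simp: ga_mult_scale_right[symmetric] cfun.subspace_scale[OF group_algebra_subspace])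
  next
    fix g f assume g: "g \<in> carrier G" and "f \<in> ?V"
    then obtain c where "f = ga_mult G a c" by blast
    hence "ga_mult G (indicator {g}) f = ga_mult G a (ga_mult G (indicator {g}) c)"
      using center_commute[OF a, of "indicator {g}"] g by (simp add: ga_mult_assoc[symmetric])
    thus "ga_mult G (indicator {g}) f \<in> ?V" by simp
  qed auto
  have "a \<in> ?V"
    using a by (intro image_eqI[of _ _ "indicator {\<one>}"])
      (auto simp: ga_mult_one_right center_group_algebra)
  hence nzV: "?V \<noteq> {0}" using nz by blast
  from ex_minimal_left_invariant[OF V nzV] obtain W
    where "left_invariant W \<and> W \<subseteq> ?V \<and> W \<noteq> {0} \<and>
      (\<forall>W'. left_invariant W' \<longrightarrow> W' \<subseteq> W \<longrightarrow> W' = {0} \<or> W' = W)" ..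
  hence W: "left_invariant W" "W \<subseteq> ?V" "W \<noteq> {0}"
    and min: "\<And>W'. left_invariant W' \<Longrightarrow> W' \<subseteq> W \<Longrightarrow> W' = {0} \<or> W' = W"
    by simp_all
  obtain B where B: "B \<subseteq> W" "cfun.independent B" "W \<subseteq> cfun.span B"
    using cfun.basis_exists[of W] by metis
  have span: "cfun.span B = W"
    using B W cfun.span_minimal[of B W] by (auto simp: left_invariant_def)
  have fin: "finite B" using B W by (intro independent_finite) (auto simp: left_invariant_def)
  from ex_bij_betw_nat_finite[OF fin] obtain b where "bij_betw b {0..<card B} B" by blast
  moreover define k where "k = card B"
  ultimately have b: "b ` {..<k} = B" "inj_on b {..<k}" by (auto simp: bij_betw_def lessThan_atLeast0)
  have k: "k > 0" using W(3) span fin by (auto simp: k_def card_gt_0_iff)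
  have bB: "cfun.independent (b ` {..<k})" "left_invariant (cfun.span (b ` {..<k}))"
    using B(2) W(1) b span by simp_all
  obtain \<rho> where r: "matrix_rep G k \<rho>"
    and act: "\<And>c u. ga_mult G c (\<lambda>x. \<Sum>j<k. u j * b j x) =
      (\<lambda>x. \<Sum>i<k. (\<Sum>j<k. rep_extend k \<rho> c $$ (i, j) * u j) * b i x)"
    by (rule left_invariant_rep[OF bB(1) b(2)])
      (use bB(2) in \<open>auto simp: left_invariant_def\<close>)
  have irr: "irreducible_rep G k \<rho>"
  proof (rule minimal_left_invariant_irreducible[OF bB(1) b(2) bB(2) k _ r act])
    show "W' = {0} \<or> W' = cfun.span (b ` {..<k})"
      if "left_invariant W'" "W' \<subseteq> cfun.span (b ` {..<k})" for W'
      using min[of W'] that b span by simp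
  qed
  let ?\<psi> = "rep_character G k \<rho>"
  have "central_char ?\<psi> a \<noteq> 0"
  proof
    assume "central_char ?\<psi> a = 0"
    hence z: "rep_extend k \<rho> a $$ (i, j) = 0" if "i < k" "j < k" for i j
      using rep_extend_center[OF irr a] that by simp
    have "b 0 = (\<lambda>x. \<Sum>j<k. (if j = 0 then 1 else 0) * b j x)"
      using k by (auto simp: fun_eq_iff if_distrib[of "\<lambda>z. z * _"] cong: if_cong)
    hence "ga_mult G a (b 0) = ga_mult G a (\<lambda>x. \<Sum>j<k. (if j = 0 then 1 else 0) * b j x)"
      by (rule arg_cong)
    also have "\<dots> = (\<lambda>x. \<Sum>i<k. (\<Sum>j<k. rep_extend k \<rho> a $$ (i, j) * (if j = 0 then 1 else 0)) * b i x)"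
      by (rule act)
    also have "\<dots> = 0" using z by (auto simp: fun_eq_iff intro!: sum.neutral)
    finally have ab: "ga_mult G a (b 0) = 0" .
    \<comment> \<open>A basis vector of the ideal has the form a c, and a (a c) = 0 forces a c = 0,
      contradicting independence.\<close>
    have b0: "b 0 \<in> B" using b k by blast
    then obtain c where "b 0 = ga_mult G a c" using B W by blast
    hence "b 0 = 0" using center_mult_square_zero[OF a, of c] ab by simp
    thus False using b0 B(2) cfun.dependent_zero by metis
  qed
  thus ?thesis using irr by (auto simp: Irr_def)
qed

end

section \<open>Partitions and bases of idempotents\<close>

text \<open>The kernel of a linear functional vanishing on the other vectors contains their span but
  not \<open>v\<close>. The functionals used later are point evaluations and central
  characters.\<close>

lemma cfun_independentI:
  assumes "\<And>v. v \<in> B \<Longrightarrow> \<exists>\<phi>. (\<forall>f g. \<phi> (f + g) = \<phi> f + \<phi> g) \<and>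
    (\<forall>c f. \<phi> (\<lambda>x. c * f x) = c * \<phi> f) \<and> \<phi> v \<noteq> (0::complex) \<and> (\<forall>u\<in>B - {v}. \<phi> u = 0)"
  shows "cfun.independent B"
  unfolding cfun.dependent_def
proof
  assume "\<exists>v\<in>B. v \<in> cfun.span (B - {v})"
  then obtain v where v: "v \<in> B" "v \<in> cfun.span (B - {v})" by blast
  from assms[OF v(1)] obtain \<phi> :: "('a \<Rightarrow> complex) \<Rightarrow> complex"
    where \<phi>: "\<And>f g. \<phi> (f + g) = \<phi> f + \<phi> g" "\<And>c f. \<phi> (\<lambda>x. c * f x) = c * \<phi> f"
      "\<phi> v \<noteq> 0" "\<And>u. u \<in> B - {v} \<Longrightarrow> \<phi> u = 0" by blast
  have "\<phi> 0 = 0" using \<phi>(1)[of 0 0] by simp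
  hence "cfun.subspace {f. \<phi> f = 0}" using \<phi>(1,2) by (simp add: cfun.subspace_def)
  hence "cfun.span (B - {v}) \<subseteq> {f. \<phi> f = 0}" using \<phi>(4) by (intro cfun.span_minimal) blast+
  thus False using v(2) \<phi>(3) by blast
qed

lemma partition_on_mem_iff:
  assumes "partition_on I P" "X \<in> P" "Y \<in> P" "x \<in> X"
  shows "x \<in> Y \<longleftrightarrow> Y = X"
  using assms disjointD[OF partition_onD2[OF assms(1)], of X Y] by blast

text \<open>Evaluation at a point of a part detects that part, as the point lies in no other
  part.\<close>

lemma independent_indicators:
  assumes P: "partition_on I P"
  shows "cfun.independent (indicator ` P :: ('i \<Rightarrow> complex) set)"
proof (rule cfun_independentI)
  fix v :: "'i \<Rightarrow> complex" assume "v \<in> indicator ` P"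
  then obtain X where X: "X \<in> P" "v = indicator X" by blast
  then obtain x where x: "x \<in> X" using partition_onD3[OF P] by (metis ex_in_conv)
  have "u x = 0" if u: "u \<in> indicator ` P - {v}" for u
  proof -
    from u obtain Y where Y: "Y \<in> P" "u = indicator Y" "Y \<noteq> X" using X by blast
    hence "x \<notin> Y" using partition_on_mem_iff[OF P X(1) Y(1) x] by simp
    thus ?thesis using Y by simp
  qed
  thus "\<exists>\<phi>. (\<forall>f g. \<phi> (f + g) = \<phi> f + \<phi> g) \<and>
    (\<forall>c f. \<phi> (\<lambda>x. c * f x) = c * \<phi> f) \<and> \<phi> v \<noteq> (0::complex) \<and> (\<forall>u\<in>indicator ` P - {v}. \<phi> u = 0)"
    using X x by (intro exI[of _ "\<lambda>f. f x"]) simp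
qed

text \<open>The points that \<open>T\<close> cannot separate from \<open>x\<close>. Superclasses
  arise this way from \<open>S\<close> on the group, and the partition of \<open>Irr G\<close>
  arises from the central characters of \<open>S\<close>.\<close>

definition value_class :: "('i \<Rightarrow> complex) set \<Rightarrow> 'i set \<Rightarrow> 'i \<Rightarrow> 'i set" where
  "value_class T I x = {y \<in> I. \<forall>f\<in>T. f x = f y}"

lemma partition_value_classes: "partition_on I (value_class T I ` I)"
proof (rule partition_onI)
  fix p q assume pq: "p \<in> value_class T I ` I" "q \<in> value_class T I ` I" "p \<noteq> q"
  then obtain x y where xy: "p = value_class T I x" "q = value_class T I y" by blast
  show "disjnt p q"
  proof (rule ccontr)
    assume "\<not> disjnt p q"
    then obtain z where "z \<in> p" "z \<in> q" by (auto simp: disjnt_def)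
    hence "\<forall>f\<in>T. f x = f z" "\<forall>f\<in>T. f y = f z" unfolding xy value_class_def by auto
    hence "f x = f y" if "f \<in> T" for f using that by metis
    hence "p = q" unfolding xy value_class_def by (intro Collect_cong conj_cong ball_cong refl) metis
    thus False using pq by blast
  qed
qed (auto simp: value_class_def)

text \<open>Constancy keeps each part inside a value class, and its own indicator in
  \<open>T\<close> separates it from all other points. This settles the uniqueness behind both
  definite descriptions.\<close>

lemma value_classes_unique:
  assumes P: "partition_on I P"
    and ind: "\<And>X. X \<in> P \<Longrightarrow> indicator X \<in> T"
    and const: "\<And>f X x y. f \<in> T \<Longrightarrow> X \<in> P \<Longrightarrow> x \<in> X \<Longrightarrow> y \<in> X \<Longrightarrow> f x = f y"
  shows "P = value_class T I ` I"
proof -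
  have eq: "X = value_class T I x" if X: "X \<in> P" "x \<in> X" for X x
  proof
    show "X \<subseteq> value_class T I x"
      using const[OF _ X(1,2)] X partition_onD1[OF P] by (auto simp: value_class_def)
    show "value_class T I x \<subseteq> X"
    proof
      fix y assume "y \<in> value_class T I x"
      hence "indicator X x = (indicator X y :: complex)" using ind[OF X(1)] by (auto simp: value_class_def)
      thus "y \<in> X" using X(2) by (auto simp: indicator_def split: if_splits)
    qed
  qed
  have "\<exists>x\<in>X. x \<in> I" if "X \<in> P" for X
    using that partition_onD3[OF P] partition_onD1[OF P] by (metis UnionI ex_in_conv)
  hence "P \<subseteq> value_class T I ` I" using eq by blast
  moreover have "value_class T I x \<in> P" if "x \<in> I" for x
    using that eq partition_onD1[OF P] by (metis UnionE)
  ultimately show ?thesis by blast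
qed

text \<open>A unital algebra of functions on a finite set under the pointwise product. Vanishing
  outside \<open>I\<close> makes its members determined by their values on \<open>I\<close>.\<close>

locale function_algebra =
  fixes T :: "('i \<Rightarrow> complex) set" and I :: "'i set"
  assumes fin: "finite I"
    and sub: "cfun.subspace T"
    and mult: "f \<in> T \<Longrightarrow> g \<in> T \<Longrightarrow> f * g \<in> T"
    and one: "indicator I \<in> T"
    and supp: "f \<in> T \<Longrightarrow> x \<notin> I \<Longrightarrow> f x = 0"
begin

text \<open>Lagrange interpolation: for each point outside the class multiply by a factor that is 1
  at \<open>x\<close> and 0 at that point. The product is constant on the class because it lies in
  \<open>T\<close>.\<close>

lemma indicator_value_class:
  assumes x: "x \<in> I"
  shows "indicator (value_class T I x) \<in> T"
proof -
  let ?X = "value_class T I x"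
  have "\<exists>F\<in>T. F x = 1 \<and> (\<forall>y\<in>Y. F y = 0)" if "finite Y" "Y \<subseteq> I - ?X" for Y
    using that
  proof (induction Y rule: finite_induct)
    case empty
    show ?case using one x by (intro bexI[of _ "indicator I"]) auto
  next
    case (insert y Y)
    then obtain F where F: "F \<in> T" "F x = 1" "\<forall>y\<in>Y. F y = 0" by auto
    from insert.prems obtain f where f: "f \<in> T" "f x \<noteq> f y" and y: "y \<in> I"
      by (auto simp: value_class_def)
    \<comment> \<open>The interpolation factor (f - f y) / (f x - f y); the constant f y is
      multiplied by the unit \<open>indicator I\<close> to stay in \<open>T\<close>.\<close>
    let ?h = "\<lambda>z. 1 / (f x - f y) * (f + (\<lambda>z. - f y * indicator I z)) z"
    have "?h \<in> T"
      by (intro cfun.subspace_scale[OF sub] cfun.subspace_add[OF sub] f one)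
    hence "F * ?h \<in> T" using F by (intro mult)
    moreover have "(F * ?h) x = 1" "(F * ?h) y = 0" "\<forall>z\<in>Y. (F * ?h) z = 0"
      using F f x y by auto
    ultimately show ?case by (metis insert_iff)
  qed
  from this[of "I - ?X"] fin obtain F where F: "F \<in> T" "F x = 1" "\<forall>y\<in>I - ?X. F y = 0" by auto
  have "F = indicator ?X"
  proof
    fix y
    show "F y = indicator ?X y"
    proof (cases "y \<in> ?X")
      case True thus ?thesis using F by (auto simp: value_class_def)
    next
      case False thus ?thesis using F supp by (cases "y \<in> I") auto
    qed
  qed
  thus ?thesis using F by simp
qed

text \<open>The coefficient at a class is the value of \<open>f\<close> at any point chosen from
  it.\<close>

lemma value_class_expansion:
  assumes f: "f \<in> T"
  shows "\<exists>c. \<forall>z\<in>I. f z = (\<Sum>X\<in>value_class T I ` I. c X * indicator X z)"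
proof (intro exI ballI)
  fix z assume z: "z \<in> I"
  let ?P = "value_class T I ` I"
  let ?c = "\<lambda>X. f (SOME x. x \<in> X)"
  let ?Z = "value_class T I z"
  note P = partition_value_classes[of I T]
  have zZ: "z \<in> ?Z" using z by (simp add: value_class_def)
  have "indicator X z = (if X = ?Z then 1 else 0 :: complex)" if "X \<in> ?P" for X
    using partition_on_mem_iff[OF P _ that zZ] z by (auto simp: indicator_def)
  hence "(\<Sum>X\<in>?P. ?c X * indicator X z) = (\<Sum>X\<in>?P. if X = ?Z then ?c ?Z else 0)"
    by (intro sum.cong) auto
  also have "\<dots> = ?c ?Z" using z fin by simp
  also have "\<dots> = f z"
  proof -
    have "(SOME x. x \<in> ?Z) \<in> ?Z" using zZ by (rule someI)
    thus ?thesis using f by (auto simp: value_class_def)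
  qed
  finally show "f z = (\<Sum>X\<in>?P. ?c X * indicator X z)" by simp
qed

end

lemma orthogonal_idempotent_basis_indicators:
  assumes "function_algebra S I"
  shows "orthogonal_idempotent_basis (*) S (indicator ` (value_class S I ` I))"
proof -
  interpret function_algebra S I by fact
  let ?P = "value_class S I ` I"
  note P = partition_value_classes[of I S]
  have BS: "indicator ` ?P \<subseteq> S" using indicator_value_class by auto
  have "f \<in> cfun.span (indicator ` ?P)" if f: "f \<in> S" for f
  proof -
    from value_class_expansion[OF f] obtain c
      where c: "\<And>z. z \<in> I \<Longrightarrow> f z = (\<Sum>X\<in>?P. c X * indicator X z)" by blast
    have "f = (\<Sum>X\<in>?P. (\<lambda>z. c X * indicator X z))"
    proof
      fix z
      show "f z = (\<Sum>X\<in>?P. (\<lambda>z. c X * indicator X z)) z"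
        using c[of z] supp[OF f, of z]
        by (cases "z \<in> I") (auto simp: sum_fun_apply value_class_def indicator_def intro!: sum.neutral)
    qed
    also have "\<dots> \<in> cfun.span (indicator ` ?P)"
      by (intro cfun.span_sum cfun.span_scale cfun.span_base) auto
    finally show ?thesis .
  qed
  hence span: "cfun.span (indicator ` ?P) = S"
    using cfun.span_minimal[OF BS sub] by blast
  have orth: "e * f = 0"
    if e: "e \<in> indicator ` ?P" and f: "f \<in> indicator ` ?P" and ne: "e \<noteq> f" for e f :: "'a \<Rightarrow> complex"
  proof -
    from e obtain X where X: "X \<in> ?P" "e = indicator X" by (rule imageE)
    from f obtain Y where Y: "Y \<in> ?P" "f = indicator Y" by (rule imageE)
    show ?thesis
      using partition_on_mem_iff[OF P X(1) Y(1)] ne unfolding X(2) Y(2)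
      by (auto simp: fun_eq_iff indicator_def)
  qed
  have idem: "e * e = e" if "e \<in> indicator ` ?P" for e :: "'a \<Rightarrow> complex"
    using that by (auto simp: fun_eq_iff indicator_def)
  show ?thesis
    unfolding orthogonal_idempotent_basis_def
    by (intro conjI ballI impI BS independent_indicators[OF P] span idem orth)
qed

text \<open>Agreeing at \<open>x\<close> and \<open>y\<close> is a linear condition satisfied by
  each generator.\<close>

lemma indicator_basis_constant:
  assumes P: "partition_on I P" and f: "f \<in> cfun.span (indicator ` P)"
    and X: "X \<in> P" "x \<in> X" "y \<in> X"
  shows "f x = (f y :: complex)"
proof -
  have "cfun.span (indicator ` P) \<subseteq> {f. f x = f y}"
  proof (rule cfun.span_minimal)
    show "indicator ` P \<subseteq> {f. f x = (f y :: complex)}"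
      using partition_on_mem_iff[OF P X(1) _ X(2)] partition_on_mem_iff[OF P X(1) _ X(3)]
      by (auto simp: indicator_def)
  qed (auto simp: cfun.subspace_def)
  thus ?thesis using f by blast
qed

context finite_group
begin

section \<open>Existence and uniqueness of the superclasses\<close>

lemma supercharacter_function_algebra:
  assumes S: "supercharacter_theory G S"
  shows "function_algebra S (carrier G)"
proof
  fix f x assume "f \<in> S" "x \<notin> carrier G"
  thus "f x = 0"
    using S center_group_algebra by (auto simp: supercharacter_theory_def group_algebra_def)
qed (use S in \<open>auto simp: supercharacter_theory_def\<close>)

lemma superclasses:
  assumes S: "supercharacter_theory G S"
  shows "partition_on (carrier G) (superclasses G S)"
    and "orthogonal_idempotent_basis (*) S (indicator ` superclasses G S)"
proof -
  let ?P = "value_class S (carrier G) ` carrier G"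
  have "superclasses G S = ?P"
    unfolding superclasses_def
  proof (rule the_equality)
    show "partition_on (carrier G) ?P \<and> orthogonal_idempotent_basis (*) S (indicator ` ?P)"
      by (intro conjI partition_value_classes orthogonal_idempotent_basis_indicators
          supercharacter_function_algebra S)
  next
    fix P assume P: "partition_on (carrier G) P \<and> orthogonal_idempotent_basis (*) S (indicator ` P)"
    show "P = ?P"
    proof (rule value_classes_unique)
      show "f x = f y" if "f \<in> S" "X \<in> P" "x \<in> X" "y \<in> X" for f X x y
        using indicator_basis_constant[of _ P f] that P
        by (auto simp: orthogonal_idempotent_basis_def)
    qed (use P in \<open>auto simp: orthogonal_idempotent_basis_def\<close>)
  qed
  thus "partition_on (carrier G) (superclasses G S)"
    "orthogonal_idempotent_basis (*) S (indicator ` superclasses G S)"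
    using S by (simp_all add: partition_value_classes orthogonal_idempotent_basis_indicators
        supercharacter_function_algebra)
qed

section \<open>Idempotents attached to sets of irreducible characters\<close>

lemma central_char_injective:
  assumes a: "a \<in> ga_center G" and b: "b \<in> ga_center G"
    and eq: "\<And>\<psi>. \<psi> \<in> Irr G \<Longrightarrow> central_char \<psi> a = central_char \<psi> b"
  shows "a = b"
proof (rule ccontr)
  assume "a \<noteq> b"
  let ?d = "a + (\<lambda>x. -1 * b x)"
  have "?d \<in> ga_center G"
    by (intro cfun.subspace_add[OF center_subspace] cfun.subspace_scale[OF center_subspace] a b)
  moreover have "?d \<noteq> 0" using \<open>a \<noteq> b\<close> by (auto simp: fun_eq_iff)
  ultimately obtain \<psi> where "\<psi> \<in> Irr G" "central_char \<psi> ?d \<noteq> 0"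
    using central_char_separates by blast
  thus False using eq[of \<psi>] unfolding central_char_add central_char_scale by simp
qed

text \<open>The elements e_\<psi> are distinct and independent, being dual to the central
  characters, and the group algebra has finite dimension.\<close>

lemma finite_Irr: "finite (Irr G)"
proof -
  have idem: "char_idempotent G \<psi> = char_idempotent G \<phi> \<longleftrightarrow> \<psi> = \<phi>"
    if "\<psi> \<in> Irr G" "\<phi> \<in> Irr G" for \<psi> \<phi>
    using central_char_idempotent[of \<psi> \<phi>] central_char_idempotent[of \<phi> \<phi>] that
    by (metis zero_neq_one)
  have "cfun.independent (char_idempotent G ` Irr G)"
  proof (rule cfun_independentI)
    fix v assume "v \<in> char_idempotent G ` Irr G"
    then obtain \<psi> where \<psi>: "\<psi> \<in> Irr G" "v = char_idempotent G \<psi>" by blast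
    show "\<exists>\<phi>. (\<forall>f g. \<phi> (f + g) = \<phi> f + \<phi> g) \<and> (\<forall>c f. \<phi> (\<lambda>x. c * f x) = c * \<phi> f) \<and>
      \<phi> v \<noteq> (0::complex) \<and> (\<forall>u\<in>char_idempotent G ` Irr G - {v}. \<phi> u = 0)"
      using \<psi> by (intro exI[of _ "central_char \<psi>"])
        (auto simp: central_char_add central_char_scale central_char_idempotent split: if_splits)
  qed
  hence "finite (char_idempotent G ` Irr G)"
    by (intro independent_finite) (auto intro: center_group_algebra char_idempotent_center)
  thus ?thesis using idem by (subst (asm) finite_image_iff) (auto intro: inj_onI)
qed

abbreviation idempotent_sum :: "('a \<Rightarrow> complex) set \<Rightarrow> 'a \<Rightarrow> complex" where
  "idempotent_sum X \<equiv> \<Sum>\<psi>\<in>X. char_idempotent G \<psi>"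

lemma idempotent_sum_center:
  assumes "X \<subseteq> Irr G"
  shows "idempotent_sum X \<in> ga_center G"
  using assms by (intro cfun.subspace_sum[OF center_subspace] char_idempotent_center) auto

lemma central_char_idempotent_sum:
  assumes X: "X \<subseteq> Irr G" and \<phi>: "\<phi> \<in> Irr G"
  shows "central_char \<phi> (idempotent_sum X) = indicator X \<phi>"
proof -
  have "central_char \<phi> (idempotent_sum X) = (\<Sum>\<psi>\<in>X. if \<phi> = \<psi> then 1 else 0)"
    unfolding central_char_sum
    using X \<phi> by (intro sum.cong) (auto simp: central_char_idempotent)
  thus ?thesis using finite_subset[OF X finite_Irr] by (simp add: indicator_def)
qed

text \<open>Under the central characters both sides become the product of two indicators, and
  central characters determine central elements.\<close>

lemma idempotent_sum_mult:
  assumes "X \<subseteq> Irr G" "Y \<subseteq> Irr G"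
  shows "ga_mult G (idempotent_sum X) (idempotent_sum Y) = idempotent_sum (X \<inter> Y)"
  using assms
  by (intro central_char_injective)
    (auto intro!: center_mult idempotent_sum_center
      simp: central_char_mult center_mult idempotent_sum_center central_char_idempotent_sum
        indicator_inter_arith le_infI1)

lemma independent_idempotent_sums:
  assumes P: "partition_on (Irr G) P"
  shows "cfun.independent (idempotent_sum ` P)"
proof (rule cfun_independentI)
  fix v assume "v \<in> idempotent_sum ` P"
  then obtain X where X: "X \<in> P" "v = idempotent_sum X" by blast
  then obtain \<psi> where \<psi>: "\<psi> \<in> X" using partition_onD3[OF P] by (metis ex_in_conv)
  have sub: "Y \<subseteq> Irr G" if "Y \<in> P" for Y using that partition_onD1[OF P] by blast
  have "central_char \<psi> u = 0" if u: "u \<in> idempotent_sum ` P - {v}" for u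
  proof -
    from u obtain Y where Y: "Y \<in> P" "u = idempotent_sum Y" "Y \<noteq> X" using X by blast
    hence "\<psi> \<notin> Y" using partition_on_mem_iff[OF P X(1) Y(1) \<psi>] by simp
    thus ?thesis using Y(2) central_char_idempotent_sum[OF sub[OF Y(1)], of \<psi>] sub[OF X(1)] \<psi> by auto
  qed
  moreover have "central_char \<psi> v = 1"
    using X(2) central_char_idempotent_sum[OF sub[OF X(1)], of \<psi>] sub[OF X(1)] \<psi> by auto
  ultimately show "\<exists>\<phi>. (\<forall>f g. \<phi> (f + g) = \<phi> f + \<phi> g) \<and> (\<forall>c f. \<phi> (\<lambda>x. c * f x) = c * \<phi> f) \<and>
      \<phi> v \<noteq> (0::complex) \<and> (\<forall>u\<in>idempotent_sum ` P - {v}. \<phi> u = 0)"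
    by (intro exI[of _ "central_char \<psi>"]) (auto simp: central_char_add central_char_scale)
qed

text \<open>The analogue of \<open>indicator_basis_constant\<close> with central characters in place
  of point evaluations.\<close>

lemma central_char_span_constant:
  assumes P: "partition_on (Irr G) P" and a: "a \<in> cfun.span (idempotent_sum ` P)"
    and X: "X \<in> P" "\<psi> \<in> X" "\<phi> \<in> X"
  shows "central_char \<psi> a = central_char \<phi> a"
proof -
  have sub: "Y \<subseteq> Irr G" if "Y \<in> P" for Y using that partition_onD1[OF P] by blast
  have Irr: "\<psi> \<in> Irr G" "\<phi> \<in> Irr G" using X sub by auto
  have "cfun.span (idempotent_sum ` P) \<subseteq> {a. central_char \<psi> a = central_char \<phi> a}"
  proof (rule cfun.span_minimal)
    have "indicator Y \<psi> = (indicator Y \<phi> :: complex)" if "Y \<in> P" for Y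
      using partition_on_mem_iff[OF P X(1) that X(2)] partition_on_mem_iff[OF P X(1) that X(3)]
      by (simp add: indicator_def)
    thus "idempotent_sum ` P \<subseteq> {a. central_char \<psi> a = central_char \<phi> a}"
      using sub Irr by (auto simp: central_char_idempotent_sum)
  qed (simp add: cfun.subspace_def central_char_add central_char_scale)
  thus ?thesis using a by blast
qed

text \<open>By \<open>central_char_injective\<close> the map \<open>central_transform\<close> embeds the center, with its
  convolution product, into the pointwise algebra of functions on \<open>Irr G\<close>.\<close>

definition central_transform :: "('a \<Rightarrow> complex) \<Rightarrow> ('a \<Rightarrow> complex) \<Rightarrow> complex" where
  "central_transform a = (\<lambda>\<psi>. if \<psi> \<in> Irr G then central_char \<psi> a else 0)"

lemma central_transform_function_algebra:
  assumes S: "supercharacter_theory G S"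
  shows "function_algebra (central_transform ` S) (Irr G)"
proof
  have SZ: "S \<subseteq> ga_center G" and sub: "cfun.subspace S" and one: "indicator {\<one>} \<in> S"
    and mult: "\<And>a b. a \<in> S \<Longrightarrow> b \<in> S \<Longrightarrow> ga_mult G a b \<in> S"
    using S by (auto simp: supercharacter_theory_def)
  show "cfun.subspace (central_transform ` S)"
    unfolding cfun.subspace_def
  proof (intro conjI ballI allI)
    have "0 = central_transform 0" by (simp add: central_transform_def fun_eq_iff)
    thus "0 \<in> central_transform ` S" using cfun.subspace_0[OF sub] by blast
  next
    fix f g assume "f \<in> central_transform ` S" "g \<in> central_transform ` S"
    then obtain a b where ab: "a \<in> S" "b \<in> S" "f = central_transform a" "g = central_transform b" by blast
    hence "f + g = central_transform (a + b)"
      by (simp add: central_transform_def fun_eq_iff central_char_add)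
    thus "f + g \<in> central_transform ` S" using cfun.subspace_add[OF sub ab(1,2)] by blast
  next
    fix f c assume "f \<in> central_transform ` S"
    then obtain a where a: "a \<in> S" "f = central_transform a" by blast
    hence "(\<lambda>\<psi>. c * f \<psi>) = central_transform (\<lambda>x. c * a x)"
      by (simp add: central_transform_def fun_eq_iff central_char_scale)
    thus "(\<lambda>\<psi>. c * f \<psi>) \<in> central_transform ` S" using cfun.subspace_scale[OF sub a(1)] by blast
  qed
  show "f * g \<in> central_transform ` S"
    if fg: "f \<in> central_transform ` S" "g \<in> central_transform ` S" for f g
  proof -
    from fg obtain a b where ab: "a \<in> S" "b \<in> S" "f = central_transform a" "g = central_transform b" by blast
    hence "a \<in> ga_center G" "b \<in> ga_center G" "ga_mult G a b \<in> ga_center G" using SZ mult by auto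
    hence "f * g = central_transform (ga_mult G a b)"
      using ab by (simp add: central_transform_def fun_eq_iff central_char_mult)
    thus ?thesis using mult[OF ab(1,2)] by blast
  qed
  have "indicator (Irr G) = central_transform (indicator {\<one>})"
    by (simp add: central_transform_def fun_eq_iff central_char_one indicator_def)
  thus "indicator (Irr G) \<in> central_transform ` S" using one by blast
qed (auto simp: central_transform_def finite_Irr)

text \<open>\<open>idempotent_sum X\<close> is the only central element with transform
  \<open>indicator X\<close>. This carries statements about indicators back into
  \<open>S\<close>.\<close>

lemma indicator_central_transform:
  assumes S: "supercharacter_theory G S" and X: "X \<subseteq> Irr G"
  shows "indicator X \<in> central_transform ` S \<longleftrightarrow> idempotent_sum X \<in> S"
proof -
  have E: "indicator X = central_transform (idempotent_sum X)"
    using X by (auto simp: central_transform_def fun_eq_iff central_char_idempotent_sum indicator_def)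
  show ?thesis
  proof
    assume "indicator X \<in> central_transform ` S"
    then obtain a where a: "a \<in> S" "central_transform (idempotent_sum X) = central_transform a"
      using E by auto
    have "idempotent_sum X = a"
    proof (rule central_char_injective)
      show "a \<in> ga_center G" using a S by (auto simp: supercharacter_theory_def)
      show "central_char \<psi> (idempotent_sum X) = central_char \<psi> a" if "\<psi> \<in> Irr G" for \<psi>
        using fun_cong[OF a(2), of \<psi>] that by (simp add: central_transform_def)
    qed (rule idempotent_sum_center[OF X])
    thus "idempotent_sum X \<in> S" using a by simp
  qed (auto simp: E)
qed

text \<open>The value classes of the transformed algebra form the partition: its indicators
  correspond to idempotents in \<open>S\<close>, and transform expansions lift by
  injectivity.\<close>

lemma superchar_partition:
  assumes S: "supercharacter_theory G S"
  shows "partition_on (Irr G) (superchar_partition G S)"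
    and "orthogonal_idempotent_basis (ga_mult G) S (idempotent_sum ` superchar_partition G S)"
proof -
  interpret T: function_algebra "central_transform ` S" "Irr G"
    by (rule central_transform_function_algebra[OF S])
  have SZ: "S \<subseteq> ga_center G" and sub: "cfun.subspace S" using S by (auto simp: supercharacter_theory_def)
  let ?P = "value_class (central_transform ` S) (Irr G) ` Irr G"
  have P: "partition_on (Irr G) ?P" by (rule partition_value_classes)
  have PI: "X \<subseteq> Irr G" if "X \<in> ?P" for X using that by (auto simp: value_class_def)
  have ES: "idempotent_sum ` ?P \<subseteq> S"
  proof
    fix e assume "e \<in> idempotent_sum ` ?P"
    then obtain X where "X \<in> ?P" "e = idempotent_sum X" by blast
    thus "e \<in> S" using indicator_central_transform[OF S PI, of X] T.indicator_value_class by auto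
  qed
  have "a \<in> cfun.span (idempotent_sum ` ?P)" if a: "a \<in> S" for a
  proof -
    from T.value_class_expansion[of "central_transform a"] a obtain c where
      c: "\<And>\<psi>. \<psi> \<in> Irr G \<Longrightarrow> central_transform a \<psi> = (\<Sum>X\<in>?P. c X * indicator X \<psi>)" by blast
    have "a = (\<Sum>X\<in>?P. (\<lambda>x. c X * idempotent_sum X x))"
    proof (rule central_char_injective)
      show "a \<in> ga_center G" using a SZ by blast
      show "(\<Sum>X\<in>?P. (\<lambda>x. c X * idempotent_sum X x)) \<in> ga_center G"
        by (intro cfun.subspace_sum[OF center_subspace] cfun.subspace_scale[OF center_subspace]
            idempotent_sum_center PI)
      fix \<psi> assume \<psi>: "\<psi> \<in> Irr G"
      have "central_char \<psi> (\<Sum>X\<in>?P. (\<lambda>x. c X * idempotent_sum X x)) = (\<Sum>X\<in>?P. c X * indicator X \<psi>)"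
        unfolding central_char_sum central_char_scale
        using \<psi> PI by (intro sum.cong refl) (simp add: central_char_idempotent_sum[unfolded central_char_sum])
      thus "central_char \<psi> a = central_char \<psi> (\<Sum>X\<in>?P. (\<lambda>x. c X * idempotent_sum X x))"
        using c[OF \<psi>] \<psi> by (simp add: central_transform_def)
    qed
    also have "\<dots> \<in> cfun.span (idempotent_sum ` ?P)"
      by (intro cfun.span_sum cfun.span_scale cfun.span_base) auto
    finally show ?thesis .
  qed
  hence span: "cfun.span (idempotent_sum ` ?P) = S"
    using cfun.span_minimal[OF ES sub] by blast
  have mult: "ga_mult G (idempotent_sum X) (idempotent_sum Y) = (if X = Y then idempotent_sum X else 0)"
    if "X \<in> ?P" "Y \<in> ?P" for X Y
  proof (cases "X = Y")
    case False
    hence "X \<inter> Y = {}" by (intro disjointD[OF partition_onD2[OF P]] that)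
    thus ?thesis using False idempotent_sum_mult[OF PI[OF that(1)] PI[OF that(2)]] by simp
  qed (use idempotent_sum_mult[OF PI[OF that(1)] PI[OF that(1)]] in simp)
  hence basis: "orthogonal_idempotent_basis (ga_mult G) S (idempotent_sum ` ?P)"
    unfolding orthogonal_idempotent_basis_def
  proof (intro conjI ballI impI ES independent_idempotent_sums[OF P] span)
    fix e f assume e: "e \<in> idempotent_sum ` ?P"
    then obtain X where X: "X \<in> ?P" "e = idempotent_sum X" by (rule imageE)
    show "ga_mult G e e = e" unfolding X(2) mult[OF X(1) X(1)] by simp
    assume f: "f \<in> idempotent_sum ` ?P" and ne: "e \<noteq> f"
    then obtain Y where Y: "Y \<in> ?P" "f = idempotent_sum Y" by blast
    show "ga_mult G e f = 0" using ne unfolding X(2) Y(2) mult[OF X(1) Y(1)] by auto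
  qed
  have eq: "superchar_partition G S = ?P"
    unfolding superchar_partition_def
  proof (rule the_equality)
    show "partition_on (Irr G) ?P \<and> orthogonal_idempotent_basis (ga_mult G) S (idempotent_sum ` ?P)"
      using P basis by blast
  next
    fix Q assume "partition_on (Irr G) Q \<and> orthogonal_idempotent_basis (ga_mult G) S (idempotent_sum ` Q)"
    hence Q: "partition_on (Irr G) Q" "idempotent_sum ` Q \<subseteq> S" "cfun.span (idempotent_sum ` Q) = S"
      by (auto simp: orthogonal_idempotent_basis_def)
    show "Q = ?P"
    proof (rule value_classes_unique[OF Q(1)])
      show "indicator X \<in> central_transform ` S" if "X \<in> Q" for X
        using that Q partition_onD1[OF Q(1)] by (subst indicator_central_transform[OF S]) auto
      fix f X \<psi> \<phi> assume f: "f \<in> central_transform ` S" and X: "X \<in> Q" "\<psi> \<in> X" "\<phi> \<in> X"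
      have "\<psi> \<in> Irr G" "\<phi> \<in> Irr G" using X partition_onD1[OF Q(1)] by auto
      thus "f \<psi> = f \<phi>"
        using f Q(3) central_char_span_constant[OF Q(1) _ X] by (auto simp: central_transform_def)
    qed
  qed
  show "partition_on (Irr G) (superchar_partition G S)"
    "orthogonal_idempotent_basis (ga_mult G) S (idempotent_sum ` superchar_partition G S)"
    unfolding eq by (fact P basis)+
qed

end

section \<open>Eigenvalues and the determinant\<close>

lemma indicator_eq_iff: "(indicator A :: 'i \<Rightarrow> complex) = indicator B \<longleftrightarrow> A = B"
  by (auto simp: fun_eq_iff indicator_def)

context finite_group
begin

text \<open>With \<open>s = e\<^sup>*\<close>, the central element \<open>e s\<close> is a multiple of \<open>e\<close>; as \<open>s\<^sup>* s = e s\<close> is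
  nonzero and \<open>s\<close> is idempotent, the factor is 1, and \<open>e = e s\<close> is self-adjoint.\<close>

lemma ga_star_char_idempotent:
  assumes \<psi>: "\<psi> \<in> Irr G"
  shows "ga_star (char_idempotent G \<psi>) = char_idempotent G \<psi>"
proof -
  define e where "e = char_idempotent G \<psi>"
  define s where "s = ga_star e"
  define c where "c = central_char \<psi> s"
  have eZ: "e \<in> ga_center G" using char_idempotent_center[OF \<psi>] by (simp add: e_def)
  hence sZ: "s \<in> ga_center G" by (simp add: s_def ga_star_center)
  have star_s: "ga_star s = e" using eZ by (simp add: s_def center_group_algebra)
  have cc: "central_char \<phi> e = (if \<phi> = \<psi> then 1 else 0)" if "\<phi> \<in> Irr G" for \<phi>
    using central_char_idempotent[OF \<psi> that] by (simp add: e_def)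
  have ee: "ga_mult G e e = e"
    using eZ by (intro central_char_injective) (auto simp: center_mult central_char_mult cc)
  have ss: "ga_mult G s s = s" unfolding s_def by (simp add: ga_star_mult[symmetric] ee)
  have es: "ga_mult G e s = (\<lambda>x. c * e x)"
    using eZ sZ
    by (intro central_char_injective)
      (auto simp: center_mult central_char_mult cc c_def central_char_scale
        intro: cfun.subspace_scale[OF center_subspace])
  have "c * c = c"
    using central_char_mult[OF \<psi> sZ sZ center_mult[OF sZ sZ]] by (simp add: ss c_def)
  moreover have "c \<noteq> 0"
  proof
    assume "c = 0"
    hence "ga_mult G (ga_star s) s = 0" using es by (simp add: star_s fun_eq_iff)
    hence "s = 0" by (rule ga_star_mult_eq_zero[OF center_group_algebra[OF sZ]])
    hence "e = 0" using star_s by (auto simp: ga_star_def)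
    thus False using cc[OF \<psi>] by simp
  qed
  ultimately have "ga_mult G e s = e" using es by simp
  moreover have "ga_star (ga_mult G e s) = ga_mult G e s"
    by (simp add: ga_star_mult star_s) (simp add: s_def)
  ultimately show ?thesis by (simp add: e_def)
qed

lemma idempotent_sum_inverse:
  assumes X: "X \<subseteq> Irr G" and x: "x \<in> carrier G"
  shows "idempotent_sum X (inv x) = cnj (idempotent_sum X x)"
proof -
  have "char_idempotent G \<psi> (inv x) = cnj (char_idempotent G \<psi> x)" if "\<psi> \<in> X" for \<psi>
    using fun_cong[OF ga_star_char_idempotent, of \<psi> "inv x"] that X x by (auto simp: ga_star_def)
  thus ?thesis by (simp add: sum_fun_apply)
qed

lemma idempotent_sum_sigma_char:
  assumes "x \<in> carrier G"
  shows "idempotent_sum X (inv x) = sigma_char G X x / of_nat (card (carrier G))"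
  using assms by (simp add: sum_fun_apply sigma_char_def char_idempotent_def sum_divide_distrib)

text \<open>The value at the unit is a nonempty sum of squares of positive degrees.\<close>

lemma sigma_char_one_nonzero:
  assumes X: "X \<subseteq> Irr G" "X \<noteq> {}"
  shows "sigma_char G X \<one> \<noteq> 0"
proof -
  have "\<exists>n::nat. n > 0 \<and> \<psi> \<one> = of_nat n" if "\<psi> \<in> X" for \<psi>
    using Irr_one_positive[of \<psi>] that X(1) by blast
  then obtain n :: "_ \<Rightarrow> nat" where n: "\<And>\<psi>. \<psi> \<in> X \<Longrightarrow> n \<psi> > 0 \<and> \<psi> \<one> = of_nat (n \<psi>)" by metis
  have "sigma_char G X \<one> = of_nat (\<Sum>\<psi>\<in>X. n \<psi> * n \<psi>)"
    unfolding sigma_char_def of_nat_sum using n by (intro sum.cong) auto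
  moreover have "(\<Sum>\<psi>\<in>X. n \<psi> * n \<psi>) \<noteq> 0"
    using n X finite_subset[OF X(1) finite_Irr] by (subst sum_eq_0_iff) auto
  ultimately show ?thesis by (metis of_nat_eq_0_iff)
qed

end

section \<open>The class basis and the idempotent basis of a fixed supercharacter theory\<close>

locale supercharacter = finite_group +
  fixes S :: "('a \<Rightarrow> complex) set"
  assumes supercharacter: "supercharacter_theory G S"
begin

lemmas class_partition = superclasses(1)[OF supercharacter]
  and char_partition = superchar_partition(1)[OF supercharacter]

lemma algebra_center: "a \<in> S \<Longrightarrow> a \<in> ga_center G"
  using supercharacter by (auto simp: supercharacter_theory_def)

lemma algebra_mult: "a \<in> S \<Longrightarrow> b \<in> S \<Longrightarrow> ga_mult G a b \<in> S"
  using supercharacter by (auto simp: supercharacter_theory_def)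

lemma class_basis:
  shows "cfun.independent (indicator ` superclasses G S :: ('a \<Rightarrow> complex) set)"
    and "cfun.span (indicator ` superclasses G S) = S"
    and "K \<in> superclasses G S \<Longrightarrow> indicator K \<in> S"
  using superclasses(2)[OF supercharacter] by (auto simp: orthogonal_idempotent_basis_def)

lemma char_basis:
  shows "cfun.independent (idempotent_sum ` superchar_partition G S)"
    and "cfun.span (idempotent_sum ` superchar_partition G S) = S"
    and "X \<in> superchar_partition G S \<Longrightarrow> idempotent_sum X \<in> S"
  using superchar_partition(2)[OF supercharacter] by (auto simp: orthogonal_idempotent_basis_def)

lemma char_part:
  assumes "X \<in> superchar_partition G S"
  shows "X \<subseteq> Irr G" "X \<noteq> {}"
  using assms partition_onD1[OF char_partition] partition_onD3[OF char_partition] by blast+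

lemma superclass_subset: "K \<in> superclasses G S \<Longrightarrow> K \<subseteq> carrier G"
  using partition_onD1[OF class_partition] by blast

lemma algebra_constant:
  assumes "a \<in> S" "K \<in> superclasses G S" "x \<in> K" "y \<in> K"
  shows "a x = a y"
  using assms indicator_basis_constant[OF class_partition, of a K x y] class_basis(2) by simp

text \<open>\<sigma>_X is read from \<open>idempotent_sum X\<close> at inverses, while membership in
  \<open>S\<close> gives constancy at x and y themselves. Self-adjointness bridges the two:
  inverting the argument only conjugates the coefficient.\<close>

lemma sigma_char_constant:
  assumes X: "X \<in> superchar_partition G S" and K: "K \<in> superclasses G S" "x \<in> K" "y \<in> K"
  shows "sigma_char G X x = sigma_char G X y"
proof -
  have xy: "x \<in> carrier G" "y \<in> carrier G" using superclass_subset[OF K(1)] K by auto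
  have "idempotent_sum X (inv x) = idempotent_sum X (inv y)"
    using algebra_constant[OF char_basis(3)[OF X] K]
    by (simp add: idempotent_sum_inverse char_part[OF X] xy)
  moreover have "card (carrier G) \<noteq> 0" by (auto simp: card_eq_0_iff)
  ultimately show ?thesis by (simp add: idempotent_sum_sigma_char xy)
qed

text \<open>Compare central characters: they take one value on \<open>a\<close> throughout X, and
  both sides vanish off X. Thus these idempotents are common eigenvectors for multiplication by
  \<open>S\<close>.\<close>

lemma mult_idempotent_sum:
  assumes a: "a \<in> S" and X: "X \<in> superchar_partition G S" "\<psi> \<in> X"
  shows "ga_mult G a (idempotent_sum X) = (\<lambda>x. central_char \<psi> a * idempotent_sum X x)"
proof (rule central_char_injective)
  note aZ = algebra_center[OF a] and EZ = idempotent_sum_center[OF char_part(1)[OF X(1)]]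
  show "ga_mult G a (idempotent_sum X) \<in> ga_center G" by (rule center_mult[OF aZ EZ])
  show "(\<lambda>x. central_char \<psi> a * idempotent_sum X x) \<in> ga_center G"
    by (rule cfun.subspace_scale[OF center_subspace EZ])
  fix \<phi> assume \<phi>: "\<phi> \<in> Irr G"
  have "central_char \<phi> a = central_char \<psi> a" if "\<phi> \<in> X"
    using central_char_span_constant[OF char_partition, of a X \<phi> \<psi>] a X that char_basis(2) by simp
  thus "central_char \<phi> (ga_mult G a (idempotent_sum X)) =
      central_char \<phi> (\<lambda>x. central_char \<psi> a * idempotent_sum X x)"
    unfolding central_char_mult[OF \<phi> aZ EZ center_mult[OF aZ EZ]] central_char_scale
      central_char_idempotent_sum[OF char_part(1)[OF X(1)] \<phi>]
    by (simp add: indicator_def)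
qed

text \<open>Compare the coefficients at the unit in \<open>K E\<^sub>X = \<omega>(K) E\<^sub>X\<close>.\<close>

lemma central_char_superclass:
  assumes X: "X \<in> superchar_partition G S" "\<psi> \<in> X" and K: "K \<in> superclasses G S" "x \<in> K"
  shows "central_char \<psi> (indicator K) = sigma_char G X x * of_nat (card K) / sigma_char G X \<one>"
proof -
  let ?N = "of_nat (card (carrier G)) :: complex"
  have N: "?N \<noteq> 0" by (auto simp: card_eq_0_iff)
  note KG = superclass_subset[OF K(1)]
  have "central_char \<psi> (indicator K) * idempotent_sum X \<one> = ga_mult G (indicator K) (idempotent_sum X) \<one>"
    unfolding mult_idempotent_sum[OF class_basis(3)[OF K(1)] X] ..
  also have "\<dots> = (\<Sum>h\<in>carrier G. indicator K h * idempotent_sum X (inv h))"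
    unfolding ga_mult_apply[OF one_closed] by (intro sum.cong) auto
  also have "\<dots> = (\<Sum>h\<in>K. idempotent_sum X (inv h))"
    using KG by (intro sum.mono_neutral_cong_right) (auto simp: indicator_def)
  also have "\<dots> = (\<Sum>h\<in>K. sigma_char G X x / ?N)"
    using KG sigma_char_constant[OF X(1) K(1) _ K(2)]
    by (intro sum.cong refl) (simp add: idempotent_sum_sigma_char subset_iff)
  also have "\<dots> = sigma_char G X x * of_nat (card K) / ?N" by simp
  finally have "central_char \<psi> (indicator K) * (sigma_char G X \<one> / ?N) =
      sigma_char G X x * of_nat (card K) / ?N"
    using idempotent_sum_sigma_char[OF one_closed, of X] by simp
  thus ?thesis using N sigma_char_one_nonzero[OF char_part[OF X(1)]] by (simp add: field_simps)
qed

lemma inj_idempotent_sum: "inj_on idempotent_sum (superchar_partition G S)"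
proof (rule inj_onI)
  fix X Y
  assume X: "X \<in> superchar_partition G S" and Y: "Y \<in> superchar_partition G S"
    and eq: "idempotent_sum X = idempotent_sum Y"
  have "\<psi> \<in> X \<longleftrightarrow> \<psi> \<in> Y" if "\<psi> \<in> Irr G" for \<psi>
    using central_char_idempotent_sum[OF char_part(1)[OF X] that]
      central_char_idempotent_sum[OF char_part(1)[OF Y] that] unfolding eq
    by (simp add: indicator_def of_bool_eq_iff)
  thus "X = Y" using char_part(1)[OF X] char_part(1)[OF Y] by blast
qed

text \<open>Both partitions index bases of the same space \<open>S\<close>.\<close>

lemma card_superchar_partition: "card (superchar_partition G S) = card (superclasses G S)"
proof -
  let ?P = "superchar_partition G S" and ?Q = "superclasses G S"
  have "card ?P = card (idempotent_sum ` ?P)" by (rule card_image[OF inj_idempotent_sum, symmetric])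
  also have "\<dots> = cfun.dim S"
    using cfun.dim_span_eq_card_independent[OF char_basis(1)] char_basis(2) by simp
  also have "\<dots> = card (indicator ` ?Q :: ('a \<Rightarrow> complex) set)"
    using cfun.dim_span_eq_card_independent[OF class_basis(1)] class_basis(2) by simp
  also have "\<dots> = card ?Q"
    by (intro card_image inj_onI) (simp add: indicator_eq_iff)
  finally show ?thesis .
qed

text \<open>\<sigma>_X determines \<open>idempotent_sum X\<close> and hence X, so a product over
  basic characters has one factor for each part.\<close>

lemma inj_sigma_char: "inj_on (sigma_char G) (superchar_partition G S)"
proof (rule inj_onI)
  fix X Y assume X: "X \<in> superchar_partition G S" and Y: "Y \<in> superchar_partition G S"
    and eq: "sigma_char G X = sigma_char G Y"
  have "idempotent_sum X = idempotent_sum Y"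
  proof (rule group_algebra_eqI)
    fix x assume "x \<in> carrier G"
    thus "idempotent_sum X x = idempotent_sum Y x"
      using idempotent_sum_sigma_char[of "inv x" X] idempotent_sum_sigma_char[of "inv x" Y] eq by simp
  qed (use X Y char_part in \<open>auto intro!: center_group_algebra idempotent_sum_center\<close>)
  thus "X = Y" using inj_idempotent_sum X Y by (blast dest: inj_onD)
qed

end

subsection \<open>Polynomial matrices\<close>

lemma cpoly_const_hom:
  "cpoly_const (a + b) = cpoly_const a + cpoly_const b"
  "cpoly_const (a * b) = cpoly_const a * cpoly_const b"
  "cpoly_const 0 = 0" "cpoly_const 1 = 1"
  by (simp_all add: cpoly_const_def single_add mult_single)

lemma cpoly_const_sum: "cpoly_const (\<Sum>i\<in>I. f i) = (\<Sum>i\<in>I. cpoly_const (f i))"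
  by (induction I rule: infinite_finite_induct) (simp_all add: cpoly_const_hom)

text \<open>Translates the \<open>finsum\<close> of matrices in the theorem into ordinary sums of
  entries.\<close>

lemma finsum_mat_index:
  fixes f :: "'i \<Rightarrow> 'r::comm_ring_1 mat"
  assumes "finite I" "\<And>k. k \<in> I \<Longrightarrow> f k \<in> carrier_mat nr nc"
  shows "finsum (module_mat TYPE('r) nr nc) f I \<in> carrier_mat nr nc \<and>
    (\<forall>i<nr. \<forall>j<nc. finsum (module_mat TYPE('r) nr nc) f I $$ (i, j) = (\<Sum>k\<in>I. f k $$ (i, j)))"
proof -
  interpret M: abelian_group "module_mat TYPE('r) nr nc" by (rule abelian_group_mat)
  show ?thesis
    using assms
  proof (induction I rule: finite_induct)
    case empty
    show ?case by (simp add: M.finsum_empty module_mat_simps)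
  next
    case (insert k I)
    have "finsum (module_mat TYPE('r) nr nc) f (insert k I) = f k + finsum (module_mat TYPE('r) nr nc) f I"
      using insert M.finsum_insert[of I k f] by (auto simp: module_mat_simps)
    thus ?case using insert by auto
  qed
qed

text \<open>The columns of \<open>Q\<close> are eigenvectors, so A Q = Q D with D diagonal. The
  polynomial ring has no division, so the determinant of \<open>Q\<close> is cancelled by means of
  the left inverse \<open>R\<close>.\<close>

lemma det_eq_prod_eigenvalues:
  fixes A Q R :: "'r::comm_ring_1 mat"
  assumes A: "A \<in> carrier_mat n n" and Q: "Q \<in> carrier_mat n n" and R: "R \<in> carrier_mat n n"
    and RQ: "R * Q = 1\<^sub>m n"
    and AQ: "\<And>i j. i < n \<Longrightarrow> j < n \<Longrightarrow> (A * Q) $$ (i, j) = Q $$ (i, j) * d j"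
  shows "det A = (\<Prod>j<n. d j)"
proof -
  let ?D = "mat n n (\<lambda>(i, j). if i = j then d i else 0)"
  have "A * Q = Q * ?D"
  proof (rule eq_matI)
    fix i j assume "i < dim_row (Q * ?D)" "j < dim_col (Q * ?D)"
    hence ij: "i < n" "j < n" using Q by auto
    have "(Q * ?D) $$ (i, j) = (\<Sum>p<n. if p = j then Q $$ (i, j) * d j else 0)"
      unfolding mult_mat_index_sum[OF Q mat_carrier ij] using ij by (intro sum.cong) auto
    thus "(A * Q) $$ (i, j) = (Q * ?D) $$ (i, j)" using AQ[OF ij] ij by simp
  qed (use A Q in auto)
  hence AQ': "det A * det Q = det Q * det ?D"
    using det_mult[OF A Q] det_mult[OF Q mat_carrier] by metis
  have RQ': "det R * det Q = 1" using det_mult[OF R Q] RQ by simp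
  have "det A = det A * (det R * det Q)" by (simp add: RQ')
  also have "\<dots> = det R * (det A * det Q)" by (rule mult.left_commute)
  also have "\<dots> = (det R * det Q) * det ?D" unfolding AQ' by (rule mult.assoc[symmetric])
  also have "\<dots> = det ?D" by (simp add: RQ')
  also have "det ?D = prod_list (diag_mat ?D)"
    by (rule det_upper_triangular[OF _ mat_carrier]) (auto simp: upper_triangular_def)
  also have "\<dots> = (\<Prod>j<n. d j)"
    by (simp add: prod_list_diag_prod lessThan_atLeast0)
  finally show ?thesis .
qed

section \<open>The determinant as a product over basic characters\<close>

theorem theorem3:
  fixes G :: "('a, 'b) monoid_scheme"
    and S :: "('a \<Rightarrow> complex) set"
    and n :: nat
    and C :: "nat \<Rightarrow> 'a set"
    and g :: "nat \<Rightarrow> 'a"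
  assumes "group G"
    and "finite (carrier G)"
    and "supercharacter_theory G S"
    and "bij_betw C {..<n} (superclasses G S)"
    and "\<And>i. i < n \<Longrightarrow> g i \<in> C i"
  shows "det (\<Oplus>\<^bsub>module_mat TYPE(cpoly) n n\<^esub> k \<in> {..<n}.
           cpoly_var k \<cdot>\<^sub>m
             map_mat cpoly_const (regular_rep G n (\<lambda>j. indicator (C j)) (indicator (C k))))
       = (\<Prod>\<chi> \<in> basic_chars G S.
           \<Sum>k<n. cpoly_const (\<chi> (g k) * of_nat (card (C k)) / \<chi> \<one>\<^bsub>G\<^esub>) * cpoly_var k)"
proof -
  interpret group G by fact
  interpret supercharacter G S
    by unfold_locales (fact assms)+
  let ?P = "superchar_partition G S" and ?Q = "superclasses G S"
  have C: "C ` {..<n} = ?Q" "inj_on C {..<n}" using assms(4) by (auto simp: bij_betw_def)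
  have CQ: "C i \<in> ?Q" if "i < n" for i using C that by auto
  have finQ: "finite ?Q" using C(1) by (metis finite_imageI finite_lessThan)
  note gC = assms(5)
  have ind: "indicator (C j) (g i) = (if i = j then 1 else 0 :: complex)" if "i < n" "j < n" for i j
    using partition_on_mem_iff[OF class_partition CQ[OF that(1)] CQ[OF that(2)] gC[OF that(1)]]
      inj_onD[OF C(2), of j i] that by (auto simp: indicator_def)
  have inS: "indicator (C i) \<in> S" if "i < n" for i using CQ[OF that] class_basis(3) by blast
  \<comment> \<open>Each representative lies in exactly one class, so the coordinates of v in the
    class basis are its values at the \<open>g i\<close>.\<close>
  have expand: "v = (\<lambda>x. \<Sum>l<n. v (g l) * indicator (C l) x)"
    and coord: "\<And>i. i < n \<Longrightarrow>
      cfun.representation ((\<lambda>j. indicator (C j)) ` {..<n}) v (indicator (C i)) = v (g i)"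
    if v: "v \<in> S" for v
  proof -
    let ?B = "(\<lambda>j. indicator (C j)) ` {..<n} :: ('a \<Rightarrow> complex) set"
    let ?r = "cfun.representation ?B v"
    have B: "?B = indicator ` ?Q" unfolding C(1)[symmetric] by auto
    have inj: "inj_on (\<lambda>j. indicator (C j) :: 'a \<Rightarrow> complex) {..<n}"
      using C(2) by (auto simp: inj_on_def indicator_eq_iff)
    have "(\<Sum>b\<in>?B. (\<lambda>x. ?r b * b x)) = v"
      using v class_basis(1,2) finQ by (intro cfun.sum_representation_eq) (auto simp: B)
    hence v_eq: "v = (\<lambda>x. \<Sum>l<n. ?r (indicator (C l)) * indicator (C l) x)"
      using inj by (auto simp: fun_eq_iff sum_fun_apply sum.reindex)
    have r: "v (g i) = ?r (indicator (C i))" if "i < n" for i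
    proof -
      have "v (g i) = (\<Sum>l<n. ?r (indicator (C l)) * indicator (C l) (g i))"
        by (rule fun_cong[OF v_eq])
      also have "\<dots> = (\<Sum>l<n. if l = i then ?r (indicator (C i)) else 0)"
        using that by (intro sum.cong) (auto simp: ind)
      finally show ?thesis using that by simp
    qed
    show "?r (indicator (C i)) = v (g i)" if "i < n" for i using r[OF that] by simp
    have "(\<lambda>x. \<Sum>l<n. v (g l) * indicator (C l) x) = (\<lambda>x. \<Sum>l<n. ?r (indicator (C l)) * indicator (C l) x)"
      using r by (intro ext sum.cong) auto
    thus "v = (\<lambda>x. \<Sum>l<n. v (g l) * indicator (C l) x)" using v_eq by simp
  qed
  define M where "M k = regular_rep G n (\<lambda>j. indicator (C j)) (indicator (C k))" for k
  have M_carrier: "M k \<in> carrier_mat n n" for k by (simp add: M_def regular_rep_def)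
  have M: "M k $$ (i, j) = ga_mult G (indicator (C k)) (indicator (C j)) (g i)"
    if "k < n" "i < n" "j < n" for k i j
    using coord[OF algebra_mult[OF inS[OF that(1)] inS[OF that(3)]] that(2)] that
    by (simp add: M_def regular_rep_def)
  have "finite ?P" using finite_elements[OF finite_Irr char_partition] .
  \<comment> \<open>Equal cardinalities allow both partitions to be indexed by the same numbers,
    which makes the change of basis square.\<close>
  moreover have "card ?P = n"
    using card_superchar_partition C card_image[OF C(2)] by simp
  ultimately obtain X where X: "bij_betw X {..<n} ?P"
    using ex_bij_betw_nat_finite[of ?P] by (auto simp: lessThan_atLeast0)
  have XP: "X i \<in> ?P" if "i < n" for i using X that by (auto simp: bij_betw_def)
  define \<psi> where "\<psi> i = (SOME \<phi>. \<phi> \<in> X i)" for i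
  have \<psi>: "\<psi> i \<in> X i" if "i < n" for i
    using char_part(2)[OF XP[OF that]] by (simp add: \<psi>_def some_in_eq)
  \<comment> \<open>Column j of \<open>Q\<close> holds the class coordinates of the j-th idempotent;
    row i of \<open>R\<close> holds the i-th central character on the class basis.\<close>
  define Q where "Q = mat n n (\<lambda>(i, j). idempotent_sum (X j) (g i))"
  define R where "R = mat n n (\<lambda>(i, j). central_char (\<psi> i) (indicator (C j)))"
  have QR_carrier: "Q \<in> carrier_mat n n" "R \<in> carrier_mat n n" by (auto simp: Q_def R_def)
  \<comment> \<open>Entry (i, j) is the i-th central character evaluated at the j-th
    idempotent.\<close>
  have RQ: "R * Q = 1\<^sub>m n"
  proof (rule eq_matI)
    fix i j assume "i < dim_row (1\<^sub>m n :: complex mat)" "j < dim_col (1\<^sub>m n :: complex mat)"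
    hence ij: "i < n" "j < n" by auto
    let ?E = "idempotent_sum (X j)"
    have "(R * Q) $$ (i, j) = (\<Sum>l<n. central_char (\<psi> i) (indicator (C l)) * ?E (g l))"
      unfolding mult_mat_index_sum[OF QR_carrier(2,1) ij] using ij by (simp add: Q_def R_def)
    also have "\<dots> = central_char (\<psi> i) (\<Sum>l<n. (\<lambda>x. ?E (g l) * indicator (C l) x))"
      unfolding central_char_sum central_char_scale by (simp add: mult.commute)
    also have "(\<Sum>l<n. (\<lambda>x. ?E (g l) * indicator (C l) x)) = ?E"
      by (subst (2) expand[OF char_basis(3)[OF XP[OF ij(2)]]]) (simp add: fun_eq_iff sum_fun_apply)
    also have "central_char (\<psi> i) ?E = indicator (X j) (\<psi> i)"
      using char_part(1)[OF XP] ij \<psi> by (intro central_char_idempotent_sum) auto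
    also have "\<dots> = 1\<^sub>m n $$ (i, j)"
      using partition_on_mem_iff[OF char_partition XP[OF ij(1)] XP[OF ij(2)] \<psi>[OF ij(1)]] ij
        inj_onD[of X "{..<n}" i j] X by (auto simp: bij_betw_def indicator_def)
    finally show "(R * Q) $$ (i, j) = 1\<^sub>m n $$ (i, j)" .
  qed (auto simp: Q_def R_def)
  \<comment> \<open>The j-th idempotent is an eigenvector of multiplication by the k-th class sum,
    with eigenvalue \<open>R $$ (j, k)\<close>.\<close>
  have MQ: "(\<Sum>l<n. M k $$ (i, l) * Q $$ (l, j)) = Q $$ (i, j) * R $$ (j, k)"
    if "k < n" "i < n" "j < n" for i j k
  proof -
    let ?E = "idempotent_sum (X j)"
    have "(\<Sum>l<n. M k $$ (i, l) * Q $$ (l, j)) =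
        (\<Sum>l<n. ?E (g l) * ga_mult G (indicator (C k)) (indicator (C l)) (g i))"
      using that by (intro sum.cong) (auto simp: M Q_def)
    also have "\<dots> = ga_mult G (indicator (C k)) (\<lambda>x. \<Sum>l<n. ?E (g l) * indicator (C l) x) (g i)"
      unfolding ga_mult_lincomb ..
    also have "(\<lambda>x. \<Sum>l<n. ?E (g l) * indicator (C l) x) = ?E"
      by (rule expand[OF char_basis(3)[OF XP[OF that(3)]], symmetric])
    also have "ga_mult G (indicator (C k)) ?E (g i) = central_char (\<psi> j) (indicator (C k)) * ?E (g i)"
      unfolding mult_idempotent_sum[OF inS[OF that(1)] XP[OF that(3)] \<psi>[OF that(3)]] ..
    finally show ?thesis using that by (simp add: Q_def R_def)
  qed
  let ?A = "\<Oplus>\<^bsub>module_mat TYPE(cpoly) n n\<^esub> k \<in> {..<n}. cpoly_var k \<cdot>\<^sub>m map_mat cpoly_const (M k)"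
  let ?Q' = "map_mat cpoly_const Q" and ?R' = "map_mat cpoly_const R"
  have A: "?A \<in> carrier_mat n n \<and> (\<forall>i<n. \<forall>j<n. ?A $$ (i, j) =
      (\<Sum>k<n. (cpoly_var k \<cdot>\<^sub>m map_mat cpoly_const (M k)) $$ (i, j)))"
    using M_carrier by (intro finsum_mat_index) auto
  have A_carrier: "?A \<in> carrier_mat n n" using A by blast
  have A_index: "?A $$ (i, j) = (\<Sum>k<n. cpoly_var k * cpoly_const (M k $$ (i, j)))"
    if "i < n" "j < n" for i j
    using A that by (simp add: carrier_matD[OF M_carrier])
  \<comment> \<open>\<open>Q\<close> and \<open>R\<close> have constant entries, so they diagonalize
    every class sum at once and stay inverse over the polynomial ring; the eigenvalues combine into
    linear forms.\<close>
  have "det ?A = (\<Prod>j<n. \<Sum>k<n. cpoly_const (R $$ (j, k)) * cpoly_var k)"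
  proof (rule det_eq_prod_eigenvalues[OF A_carrier, of ?Q' ?R'])
    show "?R' * ?Q' = 1\<^sub>m n"
    proof (rule eq_matI)
      fix i j assume "i < dim_row (1\<^sub>m n :: cpoly mat)" "j < dim_col (1\<^sub>m n :: cpoly mat)"
      hence ij: "i < n" "j < n" by auto
      have "(?R' * ?Q') $$ (i, j) = cpoly_const ((R * Q) $$ (i, j))"
        using ij QR_carrier mult_mat_index_sum[of ?R' n n ?Q' n i j]
          mult_mat_index_sum[OF QR_carrier(2,1) ij]
        by (simp add: cpoly_const_sum cpoly_const_hom del: index_mult_mat)
      thus "(?R' * ?Q') $$ (i, j) = 1\<^sub>m n $$ (i, j)"
        using ij by (simp add: RQ cpoly_const_hom del: index_mult_mat)
    qed (auto simp: Q_def R_def)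
    fix i j assume ij: "i < n" "j < n"
    have "(?A * ?Q') $$ (i, j) =
        (\<Sum>l<n. \<Sum>k<n. cpoly_var k * cpoly_const (M k $$ (i, l) * Q $$ (l, j)))"
      using ij QR_carrier A_index mult_mat_index_sum[OF A_carrier, of ?Q' n i j]
      by (simp add: sum_distrib_right cpoly_const_hom mult.assoc del: index_mult_mat)
    also have "\<dots> = (\<Sum>k<n. \<Sum>l<n. cpoly_var k * cpoly_const (M k $$ (i, l) * Q $$ (l, j)))"
      by (rule sum.swap)
    also have "\<dots> = (\<Sum>k<n. cpoly_var k * cpoly_const (\<Sum>l<n. M k $$ (i, l) * Q $$ (l, j)))"
      by (simp add: cpoly_const_sum sum_distrib_left)
    also have "\<dots> = (\<Sum>k<n. cpoly_const (Q $$ (i, j)) * (cpoly_const (R $$ (j, k)) * cpoly_var k))"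
    proof (rule sum.cong[OF refl])
      fix k assume "k \<in> {..<n}"
      hence "(\<Sum>l<n. M k $$ (i, l) * Q $$ (l, j)) = Q $$ (i, j) * R $$ (j, k)"
        using ij by (intro MQ) auto
      thus "cpoly_var k * cpoly_const (\<Sum>l<n. M k $$ (i, l) * Q $$ (l, j)) =
          cpoly_const (Q $$ (i, j)) * (cpoly_const (R $$ (j, k)) * cpoly_var k)"
        by (simp only: cpoly_const_hom ac_simps)
    qed
    also have "\<dots> = ?Q' $$ (i, j) * (\<Sum>k<n. cpoly_const (R $$ (j, k)) * cpoly_var k)"
      using ij QR_carrier by (simp add: sum_distrib_left)
    finally show "(?A * ?Q') $$ (i, j) =
      ?Q' $$ (i, j) * (\<Sum>k<n. cpoly_const (R $$ (j, k)) * cpoly_var k)" .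
  qed (use QR_carrier in auto)
  also have "\<dots> = (\<Prod>j<n. \<Sum>k<n. cpoly_const
      (sigma_char G (X j) (g k) * of_nat (card (C k)) / sigma_char G (X j) \<one>\<^bsub>G\<^esub>) * cpoly_var k)"
    by (intro prod.cong sum.cong refl)
      (simp add: R_def central_char_superclass[OF XP \<psi> CQ gC])
  also have "\<dots> = (\<Prod>Y\<in>?P. \<Sum>k<n. cpoly_const
      (sigma_char G Y (g k) * of_nat (card (C k)) / sigma_char G Y \<one>\<^bsub>G\<^esub>) * cpoly_var k)"
    by (rule prod.reindex_bij_betw[OF X])
  also have "\<dots> = (\<Prod>\<chi>\<in>basic_chars G S. \<Sum>k<n. cpoly_const
      (\<chi> (g k) * of_nat (card (C k)) / \<chi> \<one>\<^bsub>G\<^esub>) * cpoly_var k)"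
    unfolding basic_chars_def by (simp add: prod.reindex[OF inj_sigma_char])
  finally show ?thesis unfolding M_def .
qed

end
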